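(* Let $(M,g,I_1,I_2,I_3)$ be a hyper-Kähler manifold, and let $G$ be a compact Lie subgroup of the isometry group of $M$, with Lie algebra $\mathfrak{g}$, acting properly and freely on $M$ from the left, such that the action is hyper-hamiltonian. Let $\mu:M\to\mathfrak{g}^*\otimes\mathbb{R}^3$ be the hyper-Kähler momentum map. If one confines sections of the action Lie algebroid $\mathfrak{g}\ltimes M$ to the constant ones, then $\mu$ is an $\mathbb{R}^3$-valued homotopy momentum section with respect to $(\mathfrak{g}\ltimes M,\mathbf{d})$, for the $\mathbb{R}^3$-valued $1$-plectic manifold $(M,\omega^{(3)},\underline{\mathbb{R}^3}_M,\mathbf{d})$.
   Context: Hyper-Kähler manifold: a $4n$-dimensional Riemannian manifold $(M,g)$ with three almost complex structures $I_1,I_2,I_3$ satisfying $I_aI_b=-\delta_{ab}\,\mathrm{id}+\varepsilon_{abc}I_c$, giving three Kähler structures, such that the $2$-forms $\omega_a(X,Y):=g(I_aX,Y)$ are symplectic. Put $\omega^{(3)}:=\sum_{a=1}^3\omega_a\otimes\boldsymbol e_a$, with $\{\boldsymbol e_a\}$ the standard basis of $\mathbb{R}^3$; it is a closed non-degenerate $\mathbb{R}^3$-valued $2$-form, i.e. an $\mathbb{R}^3$-valued $1$-plectic form for the trivial connection $\mathbf d$ on $\underline{\mathbb{R}^3}_M=M\times\mathbb{R}^3$. For $\xi\in\mathfrak{g}$ let $\xi_M|_x=\frac{d}{dt}\big|_{t=0}\Phi_{\exp(t\xi)}(x)$, with $\Phi$ the action. The action is hyper-hamiltonian if it is Hamiltonian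 for each $\omega_a$ with a $G$-equivariant momentum map $\mu_a:M\to\mathfrak{g}^*$: $\mathrm{d}(\mu_a^\xi)=\imath_{\xi_M}\omega_a$, where $\mu_a^\xi(x)=\langle\mu_a(x),\xi\rangle$, and $\mu_a(\Phi_g(x))=\mathrm{Ad}^*_g\mu_a(x)$, where $\langle\mathrm{Ad}^*_g\lambda,\xi\rangle=\langle\lambda,\mathrm{Ad}_{g^{-1}}\xi\rangle$. The hyper-Kähler momentum map is $\mu=\sum_a\mu_a\otimes\boldsymbol e_a$. The action Lie algebroid $A=\mathfrak{g}\ltimes M$ is the trivial bundle $\mathfrak{g}\times M$ with anchor $\rho(\alpha)|_x=\alpha(x)_M|_x$ and bracket $[\alpha,\beta](x)=-[\alpha(x),\beta(x)]_{\mathfrak g}+\alpha(x)_M|_x\beta-\beta(x)_M|_x\alpha$ for $\alpha,\beta\in C^\infty(M,\mathfrak{g})$; it carries the trivial connection $\mathbf d$. Regard $\mu$ as a section of $A^*\otimes\underline{\mathbb{R}^3}_M$ and write $\mu^\alpha=\langle\mu,\alpha\rangle$. That $\mu$ is an $\mathbb{R}^3$-valued homotopy momentum section with respect to $(\mathfrak{g}\ltimes M,\mathbf d)$ with sections confined to constant ones means: for all constant sections $\alpha,\beta\in\mathfrak{g}$ and vector fields $X$, (i) $\mathbf{d}\mu^\alpha(X)=\omega^{(3)}(\rho(\alpha),X)$; (ii) $\mathbf{d}\mu^\beta(\rho(\alpha))-\mathbf{d}\mu^\alpha(\rho(\beta))-\mu^{[\alpha,\beta]}=-\omega^{(3)}(\rho(\alpha),\rho(\beta))$.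 *)

theory Defs
  imports "HOL-Analysis.Analysis" "HOL-Algebra.Group"
begin

section \<open>Smooth manifolds\<close>

text \<open>
  A manifold is a topological space (a type) with an atlas of charts \<open>(U, \<phi>)\<close> into a
  finite-dimensional real normed space \<open>'e\<close>; only the values of \<open>\<phi>\<close> on \<open>U\<close> matter.  The class
  \<open>euclidean_space\<close> is not required of model spaces because it excludes dimension \<open>0\<close>, and
  hence discrete Lie groups.

  The derivatives \<open>frechet_derivative\<close> below are only meaningful where the function is
  differentiable, which is the case for smooth data.  All of them are taken at interior points of
  the chart domains, so values off the domains are irrelevant.
\<close>

primrec Ck_on :: "nat \<Rightarrow> 'a::real_normed_vector set \<Rightarrow> ('a \<Rightarrow> 'b::real_normed_vector) \<Rightarrow> bool" where
  "Ck_on 0 S f \<longleftrightarrow> continuous_on S f"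
| "Ck_on (Suc k) S f \<longleftrightarrow>
     (\<forall>x\<in>S. f differentiable (at x)) \<and> (\<forall>v. Ck_on k S (\<lambda>x. frechet_derivative f (at x) v))"

text \<open>To be used for open \<open>S\<close> in a finite-dimensional space.\<close>

definition smooth_on :: "'a::real_normed_vector set \<Rightarrow> ('a \<Rightarrow> 'b::real_normed_vector) \<Rightarrow> bool" where
  "smooth_on S f \<longleftrightarrow> (\<forall>k. Ck_on k S f)"

type_synonym ('m, 'e) chart = "'m set \<times> ('m \<Rightarrow> 'e)"

definition chart_inv :: "('m, 'e) chart \<Rightarrow> 'e \<Rightarrow> 'm" where
  "chart_inv c = inv_into (fst c) (snd c)"

definition chart_image :: "('m, 'e) chart \<Rightarrow> 'e set" where
  "chart_image c = snd c ` fst c"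

definition smooth_manifold ::
  "('m::{t2_space,second_countable_topology}, 'e::real_normed_vector) chart set \<Rightarrow> bool" where
  "smooth_manifold A \<longleftrightarrow>
     (\<exists>B::'e set. finite B \<and> span B = UNIV) \<and>
     \<Union> (fst ` A) = UNIV \<and>
     (\<forall>c\<in>A. open (fst c) \<and> open (chart_image c) \<and>
            homeomorphism (fst c) (chart_image c) (snd c) (chart_inv c)) \<and>
     (\<forall>c\<in>A. \<forall>d\<in>A. smooth_on (snd c ` (fst c \<inter> fst d)) (snd d \<circ> chart_inv c))"

definition prod_atlas ::
  "('m, 'e) chart set \<Rightarrow> ('n, 'f) chart set \<Rightarrow> ('m \<times> 'n, 'e \<times> 'f) chart set" where
  "prod_atlas A B = {(fst c \<times> fst d, map_prod (snd c) (snd d)) | c d. c \<in> A \<and> d \<in> B}"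

text \<open>The standard one-chart atlas of a vector space.\<close>

definition flat :: "('v, 'v) chart set" where
  "flat = {(UNIV, \<lambda>v. v)}"

definition smooth_map ::
  "('m::topological_space, 'e::real_normed_vector) chart set \<Rightarrow>
   ('n::topological_space, 'f::real_normed_vector) chart set \<Rightarrow> ('m \<Rightarrow> 'n) \<Rightarrow> bool" where
  "smooth_map A B F \<longleftrightarrow> continuous_on UNIV F \<and>
     (\<forall>c\<in>A. \<forall>d\<in>B. smooth_on (snd c ` (fst c \<inter> F -` fst d)) (snd d \<circ> F \<circ> chart_inv c))"


section \<open>Tangent vectors\<close>

text \<open>
  Each point \<open>x\<close> has a preferred chart \<open>chart_at A x\<close>, and the tangent space at \<open>x\<close> is the model
  space \<open>'e\<close>: the vector \<open>v\<close> stands for the tangent vector whose components in the preferred chart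
  at \<open>x\<close> are \<open>v\<close>.  As preferred charts vary with the point in an arbitrary way, smoothness of
  a tensor field is always expressed through its components in a fixed chart.
\<close>

definition chart_at :: "('m, 'e) chart set \<Rightarrow> 'm \<Rightarrow> ('m, 'e) chart" where
  "chart_at A x = (SOME c. c \<in> A \<and> x \<in> fst c)"

definition transition_deriv ::
  "('m, 'e::real_normed_vector) chart \<Rightarrow> ('m, 'e) chart \<Rightarrow> 'm \<Rightarrow> 'e \<Rightarrow> 'e" where
  "transition_deriv c d x = frechet_derivative (snd d \<circ> chart_inv c) (at (snd c x))"

text \<open>Components in the chart \<open>c\<close> of a tangent vector at \<open>x\<close>, and the tangent vector at \<open>x\<close>
  with given components in the chart \<open>c\<close>.\<close>

definition to_chart :: "('m, 'e::real_normed_vector) chart set \<Rightarrow> ('m, 'e) chart \<Rightarrow> 'm \<Rightarrow> 'e \<Rightarrow> 'e" where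
  "to_chart A c x = transition_deriv (chart_at A x) c x"

definition from_chart :: "('m, 'e::real_normed_vector) chart set \<Rightarrow> ('m, 'e) chart \<Rightarrow> 'm \<Rightarrow> 'e \<Rightarrow> 'e" where
  "from_chart A c x = transition_deriv c (chart_at A x) x"

definition tangent_map ::
  "('m, 'e::real_normed_vector) chart set \<Rightarrow> ('n, 'f::real_normed_vector) chart set \<Rightarrow>
   ('m \<Rightarrow> 'n) \<Rightarrow> 'm \<Rightarrow> 'e \<Rightarrow> 'f" where
  "tangent_map A B F x =
     frechet_derivative (snd (chart_at B (F x)) \<circ> F \<circ> chart_inv (chart_at A x))
       (at (snd (chart_at A x) x))"

text \<open>For a vector-valued function \<open>s\<close>, seen as a section of a trivial vector bundle, this is both the
  exterior derivative and the covariant derivative for the trivial connection.\<close>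

abbreviation diff ::
  "('m, 'e::real_normed_vector) chart set \<Rightarrow> ('m \<Rightarrow> 'v::real_normed_vector) \<Rightarrow> 'm \<Rightarrow> 'e \<Rightarrow> 'v" where
  "diff A s \<equiv> tangent_map A flat s"

definition velocity :: "('m, 'e::real_normed_vector) chart set \<Rightarrow> (real \<Rightarrow> 'm) \<Rightarrow> real \<Rightarrow> 'e" where
  "velocity A \<gamma> t = tangent_map flat A \<gamma> t 1"

definition vf_in_chart ::
  "('m, 'e::real_normed_vector) chart set \<Rightarrow> ('m \<Rightarrow> 'e) \<Rightarrow> ('m, 'e) chart \<Rightarrow> 'e \<Rightarrow> 'e" where
  "vf_in_chart A X c y = to_chart A c (chart_inv c y) (X (chart_inv c y))"

definition vector_field :: "('m, 'e::real_normed_vector) chart set \<Rightarrow> ('m \<Rightarrow> 'e) \<Rightarrow> bool" where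
  "vector_field A X \<longleftrightarrow> (\<forall>c\<in>A. smooth_on (chart_image c) (vf_in_chart A X c))"

definition vf_bracket ::
  "('m, 'e::real_normed_vector) chart set \<Rightarrow> ('m \<Rightarrow> 'e) \<Rightarrow> ('m \<Rightarrow> 'e) \<Rightarrow> 'm \<Rightarrow> 'e" where
  "vf_bracket A X Y x = (let c = chart_at A x in
     frechet_derivative (vf_in_chart A Y c) (at (snd c x)) (X x) -
     frechet_derivative (vf_in_chart A X c) (at (snd c x)) (Y x))"


section \<open>Differential forms and hyper-Kaehler structures\<close>

definition bilinear_in_chart ::
  "('m, 'e::real_normed_vector) chart set \<Rightarrow> ('m \<Rightarrow> 'e \<Rightarrow> 'e \<Rightarrow> 'v) \<Rightarrow> ('m, 'e) chart \<Rightarrow>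
   'e \<Rightarrow> 'e \<Rightarrow> 'e \<Rightarrow> 'v" where
  "bilinear_in_chart A \<omega> c y u v =
     \<omega> (chart_inv c y) (from_chart A c (chart_inv c y) u) (from_chart A c (chart_inv c y) v)"

definition smooth_bilinear_field ::
  "('m, 'e::real_normed_vector) chart set \<Rightarrow> ('m \<Rightarrow> 'e \<Rightarrow> 'e \<Rightarrow> 'v::real_normed_vector) \<Rightarrow> bool" where
  "smooth_bilinear_field A \<omega> \<longleftrightarrow> (\<forall>x. bilinear (\<omega> x)) \<and>
     (\<forall>c\<in>A. \<forall>u v. smooth_on (chart_image c) (\<lambda>y. bilinear_in_chart A \<omega> c y u v))"

definition two_form ::
  "('m, 'e::real_normed_vector) chart set \<Rightarrow> ('m \<Rightarrow> 'e \<Rightarrow> 'e \<Rightarrow> 'v::real_normed_vector) \<Rightarrow> bool" where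
  "two_form A \<omega> \<longleftrightarrow> smooth_bilinear_field A \<omega> \<and> (\<forall>x u. \<omega> x u u = 0)"

text \<open>Evaluating \<open>d\<omega>\<close> on constant coordinate fields \<open>u\<close>, \<open>v\<close>, \<open>w\<close>, whose brackets vanish.\<close>

definition closed_two_form ::
  "('m, 'e::real_normed_vector) chart set \<Rightarrow> ('m \<Rightarrow> 'e \<Rightarrow> 'e \<Rightarrow> 'v::real_normed_vector) \<Rightarrow> bool" where
  "closed_two_form A \<omega> \<longleftrightarrow> (\<forall>c\<in>A. \<forall>y\<in>chart_image c. \<forall>u v w.
     frechet_derivative (\<lambda>y. bilinear_in_chart A \<omega> c y v w) (at y) u -
     frechet_derivative (\<lambda>y. bilinear_in_chart A \<omega> c y u w) (at y) v +
     frechet_derivative (\<lambda>y. bilinear_in_chart A \<omega> c y u v) (at y) w = 0)"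

text \<open>\<open>'v\<close>-valued 1-plectic forms, closed with respect to the trivial connection on the trivial
  bundle with fibre \<open>'v\<close>; symplectic forms are the case \<open>'v = real\<close>.\<close>

definition one_plectic ::
  "('m, 'e::real_normed_vector) chart set \<Rightarrow> ('m \<Rightarrow> 'e \<Rightarrow> 'e \<Rightarrow> 'v::real_normed_vector) \<Rightarrow> bool" where
  "one_plectic A \<omega> \<longleftrightarrow> two_form A \<omega> \<and> closed_two_form A \<omega> \<and>
     (\<forall>x u. (\<forall>v. \<omega> x u v = 0) \<longrightarrow> u = 0)"

abbreviation symplectic ::
  "('m, 'e::real_normed_vector) chart set \<Rightarrow> ('m \<Rightarrow> 'e \<Rightarrow> 'e \<Rightarrow> real) \<Rightarrow> bool" where
  "symplectic A \<omega> \<equiv> one_plectic A \<omega>"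

definition riemannian_metric ::
  "('m, 'e::real_normed_vector) chart set \<Rightarrow> ('m \<Rightarrow> 'e \<Rightarrow> 'e \<Rightarrow> real) \<Rightarrow> bool" where
  "riemannian_metric A g \<longleftrightarrow> smooth_bilinear_field A g \<and>
     (\<forall>x u v. g x u v = g x v u) \<and> (\<forall>x u. u \<noteq> 0 \<longrightarrow> g x u u > 0)"

definition almost_complex ::
  "('m, 'e::real_normed_vector) chart set \<Rightarrow> ('m \<Rightarrow> 'e \<Rightarrow> 'e) \<Rightarrow> bool" where
  "almost_complex A J \<longleftrightarrow> (\<forall>x. linear (J x)) \<and>
     (\<forall>c\<in>A. \<forall>u. smooth_on (chart_image c)
        (vf_in_chart A (\<lambda>x. J x (from_chart A c x u)) c)) \<and>
     (\<forall>x u. J x (J x u) = - u)"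

text \<open>Integrability as vanishing of the Nijenhuis tensor.\<close>

definition integrable_complex ::
  "('m, 'e::real_normed_vector) chart set \<Rightarrow> ('m \<Rightarrow> 'e \<Rightarrow> 'e) \<Rightarrow> bool" where
  "integrable_complex A J \<longleftrightarrow> (\<forall>X Y. vector_field A X \<longrightarrow> vector_field A Y \<longrightarrow> (\<forall>x.
     vf_bracket A (\<lambda>x. J x (X x)) (\<lambda>x. J x (Y x)) x
       - J x (vf_bracket A (\<lambda>x. J x (X x)) Y x)
       - J x (vf_bracket A X (\<lambda>x. J x (Y x)) x)
       - vf_bracket A X Y x = 0))"

definition fundamental_form ::
  "('m \<Rightarrow> 'e \<Rightarrow> 'e \<Rightarrow> real) \<Rightarrow> ('m \<Rightarrow> 'e \<Rightarrow> 'e) \<Rightarrow> 'm \<Rightarrow> 'e \<Rightarrow> 'e \<Rightarrow> real" where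
  "fundamental_form g J x u v = g x (J x u) v"

definition kaehler ::
  "('m, 'e::real_normed_vector) chart set \<Rightarrow> ('m \<Rightarrow> 'e \<Rightarrow> 'e \<Rightarrow> real) \<Rightarrow> ('m \<Rightarrow> 'e \<Rightarrow> 'e) \<Rightarrow> bool" where
  "kaehler A g J \<longleftrightarrow> riemannian_metric A g \<and> almost_complex A J \<and> integrable_complex A J \<and>
     (\<forall>x u v. g x (J x u) (J x v) = g x u v) \<and> symplectic A (fundamental_form g J)"

text \<open>Indices range over the three-element type \<open>3\<close>, in which \<open>3 = 0\<close>.\<close>

definition levi_civita :: "3 \<Rightarrow> 3 \<Rightarrow> 3 \<Rightarrow> real" where
  "levi_civita a b c =
     (if (a, b, c) \<in> {(1, 2, 3), (2, 3, 1), (3, 1, 2)} then 1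
      else if (a, b, c) \<in> {(1, 3, 2), (3, 2, 1), (2, 1, 3)} then - 1 else 0)"

definition hyper_kaehler ::
  "('m::{t2_space,second_countable_topology}, 'e::euclidean_space) chart set \<Rightarrow>
   ('m \<Rightarrow> 'e \<Rightarrow> 'e \<Rightarrow> real) \<Rightarrow> (3 \<Rightarrow> 'm \<Rightarrow> 'e \<Rightarrow> 'e) \<Rightarrow> bool" where
  "hyper_kaehler A g I \<longleftrightarrow> smooth_manifold A \<and> (\<exists>n. DIM('e) = 4 * n) \<and>
     (\<forall>a. kaehler A g (I a)) \<and>
     (\<forall>a b x u. I a x (I b x u) =
        - (if a = b then 1 else 0) *\<^sub>R u + (\<Sum>c\<in>UNIV. levi_civita a b c *\<^sub>R I c x u))"

definition hyper_kaehler_form ::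
  "('m \<Rightarrow> 'e \<Rightarrow> 'e \<Rightarrow> real) \<Rightarrow> (3 \<Rightarrow> 'm \<Rightarrow> 'e \<Rightarrow> 'e) \<Rightarrow> 'm \<Rightarrow> 'e \<Rightarrow> 'e \<Rightarrow> real ^ 3" where
  "hyper_kaehler_form g I x u v =
     (\<Sum>a\<in>UNIV. fundamental_form g (I a) x u v *\<^sub>R axis a 1)"

definition isometry_group ::
  "('m::topological_space, 'e::real_normed_vector) chart set \<Rightarrow>
   ('m \<Rightarrow> 'e \<Rightarrow> 'e \<Rightarrow> real) \<Rightarrow> ('m \<Rightarrow> 'm) monoid" where
  "isometry_group A g =
     \<lparr>carrier = {F. bij F \<and> smooth_map A A F \<and> smooth_map A A (inv_into UNIV F) \<and>
        (\<forall>x u v. g (F x) (tangent_map A A F x u) (tangent_map A A F x v) = g x u v)},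
      monoid.mult = (\<circ>), one = id\<rparr>"


section \<open>Lie groups and their actions\<close>

text \<open>The Lie algebra of \<open>G\<close> is the tangent space at the identity, i.e. the model space \<open>'f\<close>,
  with the bracket of left-invariant vector fields.\<close>

definition lie_group ::
  "'g monoid \<Rightarrow>
   ('g::{t2_space,second_countable_topology}, 'f::real_normed_vector) chart set \<Rightarrow> bool" where
  "lie_group G B \<longleftrightarrow> group G \<and> carrier G = UNIV \<and> smooth_manifold B \<and>
     smooth_map (prod_atlas B B) B (\<lambda>(a, b). a \<otimes>\<^bsub>G\<^esub> b) \<and> smooth_map B B (\<lambda>a. inv\<^bsub>G\<^esub> a)"

definition left_invariant_vf ::
  "'g monoid \<Rightarrow> ('g, 'f::real_normed_vector) chart set \<Rightarrow> 'f \<Rightarrow> 'g \<Rightarrow> 'f" where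
  "left_invariant_vf G B \<xi> a = tangent_map B B (\<lambda>b. a \<otimes>\<^bsub>G\<^esub> b) \<one>\<^bsub>G\<^esub> \<xi>"

definition lie_algebra_bracket ::
  "'g monoid \<Rightarrow> ('g, 'f::real_normed_vector) chart set \<Rightarrow> 'f \<Rightarrow> 'f \<Rightarrow> 'f" where
  "lie_algebra_bracket G B \<xi> \<eta> =
     vf_bracket B (left_invariant_vf G B \<xi>) (left_invariant_vf G B \<eta>) \<one>\<^bsub>G\<^esub>"

definition one_parameter_subgroup ::
  "'g monoid \<Rightarrow> ('g::topological_space, 'f::real_normed_vector) chart set \<Rightarrow> (real \<Rightarrow> 'g) \<Rightarrow> bool" where
  "one_parameter_subgroup G B \<gamma> \<longleftrightarrow>
     smooth_map flat B \<gamma> \<and> (\<forall>s t. \<gamma> (s + t) = \<gamma> s \<otimes>\<^bsub>G\<^esub> \<gamma> t)"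

definition lie_exp ::
  "'g monoid \<Rightarrow> ('g::topological_space, 'f::real_normed_vector) chart set \<Rightarrow> 'f \<Rightarrow> 'g" where
  "lie_exp G B \<xi> = (THE \<gamma>. one_parameter_subgroup G B \<gamma> \<and> velocity B \<gamma> 0 = \<xi>) 1"

definition adjoint_rep ::
  "'g monoid \<Rightarrow> ('g, 'f::real_normed_vector) chart set \<Rightarrow> 'g \<Rightarrow> 'f \<Rightarrow> 'f" where
  "adjoint_rep G B a = tangent_map B B (\<lambda>b. a \<otimes>\<^bsub>G\<^esub> b \<otimes>\<^bsub>G\<^esub> inv\<^bsub>G\<^esub> a) \<one>\<^bsub>G\<^esub>"

text \<open>The dual of the Lie algebra is \<open>'f \<Rightarrow>\<^sub>L real\<close>, all linear forms being bounded in finite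
  dimension.\<close>

definition coadjoint_rep ::
  "'g monoid \<Rightarrow> ('g, 'f::real_normed_vector) chart set \<Rightarrow> 'g \<Rightarrow> ('f \<Rightarrow>\<^sub>L real) \<Rightarrow> ('f \<Rightarrow>\<^sub>L real)" where
  "coadjoint_rep G B a l = l o\<^sub>L Blinfun (adjoint_rep G B (inv\<^bsub>G\<^esub> a))"

text \<open>\<open>G\<close> is a Lie subgroup of the isometry group via the injective homomorphism \<open>\<Phi>\<close>;
  smoothness of \<open>\<Phi>\<close> as a map into the isometry group is smoothness of the action map.\<close>

definition lie_subgroup_of_isometries ::
  "'g monoid \<Rightarrow> ('g::{t2_space,second_countable_topology}, 'f::real_normed_vector) chart set \<Rightarrow>
   ('m::{t2_space,second_countable_topology}, 'e::real_normed_vector) chart set \<Rightarrow>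
   ('m \<Rightarrow> 'e \<Rightarrow> 'e \<Rightarrow> real) \<Rightarrow> ('g \<Rightarrow> 'm \<Rightarrow> 'm) \<Rightarrow> bool" where
  "lie_subgroup_of_isometries G B A g \<Phi> \<longleftrightarrow> lie_group G B \<and>
     \<Phi> \<in> hom G (isometry_group A g) \<and> inj \<Phi> \<and>
     smooth_map (prod_atlas B A) A (\<lambda>(a, x). \<Phi> a x)"

definition proper_action :: "('g::topological_space \<Rightarrow> 'm::topological_space \<Rightarrow> 'm) \<Rightarrow> bool" where
  "proper_action \<Phi> \<longleftrightarrow> proper_map euclidean euclidean (\<lambda>(a, x). (\<Phi> a x, x))"

definition free_action :: "'g monoid \<Rightarrow> ('g \<Rightarrow> 'm \<Rightarrow> 'm) \<Rightarrow> bool" where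
  "free_action G \<Phi> \<longleftrightarrow> (\<forall>a x. \<Phi> a x = x \<longrightarrow> a = \<one>\<^bsub>G\<^esub>)"

definition fundamental_vf ::
  "'g monoid \<Rightarrow> ('g::topological_space, 'f::real_normed_vector) chart set \<Rightarrow>
   ('m, 'e::real_normed_vector) chart set \<Rightarrow> ('g \<Rightarrow> 'm \<Rightarrow> 'm) \<Rightarrow> 'f \<Rightarrow> 'm \<Rightarrow> 'e" where
  "fundamental_vf G B A \<Phi> \<xi> x = velocity A (\<lambda>t. \<Phi> (lie_exp G B (t *\<^sub>R \<xi>)) x) 0"

definition momentum_map ::
  "'g monoid \<Rightarrow> ('g::topological_space, 'f::real_normed_vector) chart set \<Rightarrow>
   ('m::topological_space, 'e::real_normed_vector) chart set \<Rightarrow> ('g \<Rightarrow> 'm \<Rightarrow> 'm) \<Rightarrow>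
   ('m \<Rightarrow> 'e \<Rightarrow> 'e \<Rightarrow> real) \<Rightarrow> ('m \<Rightarrow> 'f \<Rightarrow>\<^sub>L real) \<Rightarrow> bool" where
  "momentum_map G B A \<Phi> \<omega> \<mu> \<longleftrightarrow> smooth_map A flat \<mu> \<and>
     (\<forall>\<xi> x v. diff A (\<lambda>x. blinfun_apply (\<mu> x) \<xi>) x v = \<omega> x (fundamental_vf G B A \<Phi> \<xi> x) v) \<and>
     (\<forall>a x. \<mu> (\<Phi> a x) = coadjoint_rep G B a (\<mu> x))"

text \<open>The action is hyper-hamiltonian with momentum maps \<open>\<mu> 1\<close>, \<open>\<mu> 2\<close>, \<open>\<mu> 3\<close>.\<close>

definition hyper_hamiltonian ::
  "'g monoid \<Rightarrow> ('g::topological_space, 'f::real_normed_vector) chart set \<Rightarrow>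
   ('m::topological_space, 'e::real_normed_vector) chart set \<Rightarrow> ('g \<Rightarrow> 'm \<Rightarrow> 'm) \<Rightarrow>
   ('m \<Rightarrow> 'e \<Rightarrow> 'e \<Rightarrow> real) \<Rightarrow> (3 \<Rightarrow> 'm \<Rightarrow> 'e \<Rightarrow> 'e) \<Rightarrow> (3 \<Rightarrow> 'm \<Rightarrow> 'f \<Rightarrow>\<^sub>L real) \<Rightarrow> bool" where
  "hyper_hamiltonian G B A \<Phi> g I \<mu> \<longleftrightarrow>
     (\<forall>a. momentum_map G B A \<Phi> (fundamental_form g (I a)) (\<mu> a))"

text \<open>The tensor product of the dual Lie algebra with \<open>real ^ 3\<close> is \<open>'f \<Rightarrow>\<^sub>L (real ^ 3)\<close>, where
  \<open>l \<otimes> e\<close> is the map \<open>\<xi> \<mapsto> l \<xi> *\<^sub>R e\<close>.\<close>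

definition hyper_kaehler_momentum_map ::
  "(3 \<Rightarrow> 'm \<Rightarrow> 'f::real_normed_vector \<Rightarrow>\<^sub>L real) \<Rightarrow> 'm \<Rightarrow> 'f \<Rightarrow>\<^sub>L (real ^ 3)" where
  "hyper_kaehler_momentum_map \<mu> x = (\<Sum>a\<in>UNIV. blinfun_scaleR_left (axis a 1) o\<^sub>L \<mu> a x)"


section \<open>The action Lie algebroid and homotopy momentum sections\<close>

definition action_anchor ::
  "'g monoid \<Rightarrow> ('g::topological_space, 'f::real_normed_vector) chart set \<Rightarrow>
   ('m, 'e::real_normed_vector) chart set \<Rightarrow> ('g \<Rightarrow> 'm \<Rightarrow> 'm) \<Rightarrow> ('m \<Rightarrow> 'f) \<Rightarrow> 'm \<Rightarrow> 'e" where
  "action_anchor G B A \<Phi> \<alpha> x = fundamental_vf G B A \<Phi> (\<alpha> x) x"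

definition action_bracket ::
  "'g monoid \<Rightarrow> ('g::topological_space, 'f::real_normed_vector) chart set \<Rightarrow>
   ('m, 'e::real_normed_vector) chart set \<Rightarrow> ('g \<Rightarrow> 'm \<Rightarrow> 'm) \<Rightarrow>
   ('m \<Rightarrow> 'f) \<Rightarrow> ('m \<Rightarrow> 'f) \<Rightarrow> 'm \<Rightarrow> 'f" where
  "action_bracket G B A \<Phi> \<alpha> \<beta> x =
     - lie_algebra_bracket G B (\<alpha> x) (\<beta> x)
     + diff A \<beta> x (fundamental_vf G B A \<Phi> (\<alpha> x) x)
     - diff A \<alpha> x (fundamental_vf G B A \<Phi> (\<beta> x) x)"

definition pairing ::
  "('m \<Rightarrow> 'f::real_normed_vector \<Rightarrow>\<^sub>L 'v::real_normed_vector) \<Rightarrow> ('m \<Rightarrow> 'f) \<Rightarrow> 'm \<Rightarrow> 'v" where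
  "pairing \<mu> \<alpha> x = blinfun_apply (\<mu> x) (\<alpha> x)"

text \<open>
  The Lie algebroid is the trivial bundle with fibre \<open>'f\<close>, anchor \<open>\<rho>\<close>, bracket \<open>br\<close> and trivial
  connection; its sections are confined to the constant ones.
\<close>

definition homotopy_momentum_section_on_constants ::
  "('m::topological_space, 'e::real_normed_vector) chart set \<Rightarrow>
   (('m \<Rightarrow> 'f::real_normed_vector) \<Rightarrow> 'm \<Rightarrow> 'e) \<Rightarrow> (('m \<Rightarrow> 'f) \<Rightarrow> ('m \<Rightarrow> 'f) \<Rightarrow> 'm \<Rightarrow> 'f) \<Rightarrow>
   ('m \<Rightarrow> 'e \<Rightarrow> 'e \<Rightarrow> 'v::real_normed_vector) \<Rightarrow> ('m \<Rightarrow> 'f \<Rightarrow>\<^sub>L 'v) \<Rightarrow> bool" where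
  "homotopy_momentum_section_on_constants A \<rho> br \<omega> \<mu> \<longleftrightarrow> smooth_map A flat \<mu> \<and>
     (\<forall>\<xi> \<eta>. let \<alpha> = (\<lambda>_. \<xi>); \<beta> = (\<lambda>_. \<eta>) in
        (\<forall>X. vector_field A X \<longrightarrow>
           (\<forall>x. diff A (pairing \<mu> \<alpha>) x (X x) = \<omega> x (\<rho> \<alpha> x) (X x))) \<and>
        (\<forall>x. diff A (pairing \<mu> \<beta>) x (\<rho> \<alpha> x) - diff A (pairing \<mu> \<alpha>) x (\<rho> \<beta> x)
              - pairing \<mu> (br \<alpha> \<beta>) x = - \<omega> x (\<rho> \<alpha> x) (\<rho> \<beta> x)))"

end

theory Submission
  imports Defs
begin

text \<open>
  The first condition holds componentwise by the definition of the three momentum maps.  For the second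
  it suffices that the derivative of \<open>\<mu>\<^sup>\<eta>\<close> along the fundamental vector field of \<open>\<xi>\<close> is
  \<open>- \<mu>\<close> evaluated at \<open>[\<xi>, \<eta>]\<close>, the value of \<open>\<mu>\<close> on the algebroid bracket of the constant sections.
  This is the derivative at \<open>t = 0\<close> of the equivariance of \<open>\<mu>\<close> under \<open>exp (t \<xi>)\<close>, once
  \<open>exp (t \<xi>)\<close> is known to be the one-parameter subgroup with velocity \<open>\<xi>\<close> and the derivative of
  \<open>Ad\<close> along it to be the bracket of left-invariant fields.  In a chart at the identity, one-parameter
  subgroups are integral curves of a smooth vector field; Picard iteration gives them near \<open>0\<close>, left
  invariance makes them local homomorphisms, and these extend to the whole line.
\<close>

section \<open>Calculus of smooth functions\<close>

text \<open>\<open>lie_exp\<close> is a definite description, so nothing about fundamental vector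
  fields can be computed until exactly one one-parameter subgroup with each velocity is known to
  exist. Short intervals suffice for the differential equations, because the group law propagates
  both existence and uniqueness. Expanding the moving direction in a finite frame reduces every such
  case to fixed directions. Finally, Ad is a first derivative of the multiplication, so its
  derivative along a flow is a second derivative. The Lie bracket contains the same second
  derivative with the slots taken in the other order, which is why symmetry of second derivatives
  has to be available.\<close>

text \<open>Finite Parseval frames supply coordinates on a finite-dimensional inner product space that may
  have dimension \<open>0\<close> and hence is not of class \<open>euclidean_space\<close>.\<close>

definition parseval_frame :: "'a::real_inner set \<Rightarrow> bool" where
  "parseval_frame E \<longleftrightarrow> finite E \<and> 0 \<notin> E \<and> (\<forall>x. (\<Sum>b\<in>E. inner x b *\<^sub>R b) = x)"

lemma parseval_frameD:
  assumes "parseval_frame E"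
  shows "finite E" "0 \<notin> E" "(\<Sum>b\<in>E. inner x b *\<^sub>R b) = x"
  using assms by (auto simp: parseval_frame_def)

lemma parseval_frame_Basis: "parseval_frame (Basis :: 'a::euclidean_space set)"
  by (auto simp: parseval_frame_def euclidean_representation)

text \<open>Orthogonalise the spanning set, drop the zero vector and normalise. The expansion
  identity is linear in \<open>x\<close> and holds on the orthonormal set itself, hence on its
  span.\<close>

lemma parseval_frame_exists:
  fixes B :: "'a::real_inner set"
  assumes "finite B" "span B = UNIV"
  obtains E :: "'a set" where "parseval_frame E"
proof -
  obtain C where C: "finite C" "span C = span B" "pairwise orthogonal C"
    using basis_orthogonal[OF assms(1)] by blast
  define E where "E = (\<lambda>b. b /\<^sub>R norm b) ` (C - {0})"
  have finE: "finite E" and "0 \<notin> E"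
    using C by (auto simp: E_def)
  have orth: "inner x b = (if x = b then 1 else 0)" if xb: "x \<in> E" "b \<in> E" for x b
  proof -
    obtain c d where cd: "c \<in> C" "c \<noteq> 0" "x = c /\<^sub>R norm c" "d \<in> C" "d \<noteq> 0" "b = d /\<^sub>R norm d"
      using xb by (auto simp: E_def)
    show ?thesis
    proof (cases "c = d")
      case True
      then show ?thesis using cd by (simp add: dot_square_norm power2_eq_square)
    next
      case False
      then have "inner c d = 0"
        using C(3) cd by (auto simp: pairwise_def orthogonal_def)
      then have "inner x b = 0" using cd by simp
      moreover have "inner x x = 1" using cd by (simp add: dot_square_norm power2_eq_square)
      ultimately show ?thesis by auto
    qed
  qed
  have "c \<in> span E" if "c \<in> C" for c
  proof (cases "c = 0")
    case False
    then have "norm c *\<^sub>R (c /\<^sub>R norm c) \<in> span E"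
      using that by (intro span_scale span_base) (auto simp: E_def)
    then show ?thesis using False by simp
  qed (auto simp: span_zero)
  then have "span E = UNIV"
    using C assms(2) span_minimal[of C "span E"] by auto
  moreover have "(\<Sum>b\<in>E. inner x b *\<^sub>R b) = x" if "x \<in> span E" for x
    using that
  proof (induction rule: span_induct_alt)
    case base
    then show ?case by simp
  next
    case (step c x y)
    have "(\<Sum>b\<in>E. inner x b *\<^sub>R b) = (\<Sum>b\<in>E. if x = b then b else 0)"
      by (intro sum.cong) (auto simp: orth step)
    also have "\<dots> = x"
      using finE step by simp
    finally have x: "(\<Sum>b\<in>E. inner x b *\<^sub>R b) = x" .
    have "(\<Sum>b\<in>E. inner (c *\<^sub>R x + y) b *\<^sub>R b) = c *\<^sub>R (\<Sum>b\<in>E. inner x b *\<^sub>R b) + (\<Sum>b\<in>E. inner y b *\<^sub>R b)"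
      by (simp add: inner_add_left scaleR_add_left sum.distrib scaleR_sum_right)
    then show ?case using x step by simp
  qed
  ultimately show ?thesis
    using that finE \<open>0 \<notin> E\<close> by (auto simp: parseval_frame_def)
qed

text \<open>Group multiplication in a chart lives on a product space, which therefore needs a frame
  too. Excluding \<open>0\<close> from frames makes the two embedded copies disjoint, so the sum
  over their union splits.\<close>

lemma parseval_frame_prod:
  assumes E: "parseval_frame E" and F: "parseval_frame F"
  shows "parseval_frame ((\<lambda>b. (b, 0)) ` E \<union> (\<lambda>b. (0, b)) ` F)"
proof -
  have disj: "(\<lambda>b. (b, 0)) ` E \<inter> (\<lambda>b. (0, b)) ` F = {}"
    using parseval_frameD(2)[OF E] by auto
  have i1: "inj_on (\<lambda>b. (b, 0)) E" and i2: "inj_on (\<lambda>b. (0, b)) F"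
    by (auto simp: inj_on_def)
  have "(\<Sum>b\<in>(\<lambda>b. (b, 0)) ` E \<union> (\<lambda>b. (0, b)) ` F. inner x b *\<^sub>R b) = x" for x
  proof (cases x)
    case (Pair y z)
    have "(\<Sum>b\<in>(\<lambda>b. (b, 0)) ` E \<union> (\<lambda>b. (0, b)) ` F. inner x b *\<^sub>R b)
      = (\<Sum>b\<in>E. inner x (b, 0) *\<^sub>R (b, 0)) + (\<Sum>b\<in>F. inner x (0, b) *\<^sub>R (0, b))"
      using sum.union_disjoint[OF _ _ disj] parseval_frameD(1)[OF E] parseval_frameD(1)[OF F]
      by (simp add: sum.reindex[OF i1] sum.reindex[OF i2] del: scaleR_Pair)
    also have "\<dots> = ((\<Sum>b\<in>E. inner y b *\<^sub>R b), 0) + (0, (\<Sum>b\<in>F. inner z b *\<^sub>R b))"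
      by (simp add: Pair sum_prod)
    also have "\<dots> = x"
      by (simp add: Pair parseval_frameD(3)[OF E] parseval_frameD(3)[OF F])
    finally show ?thesis .
  qed
  then show ?thesis
    using parseval_frameD[OF E] parseval_frameD[OF F]
    by (auto simp: parseval_frame_def zero_prod_def)
qed

section \<open>Functions of class C^k and their calculus\<close>

lemma frechet_derivative_eqI:
  assumes "(f has_derivative f') (at x)"
  shows "frechet_derivative f (at x) = f'"
  using frechet_derivative_at[OF assms] by simp

text \<open>No differentiability is assumed: \<open>frechet_derivative\<close> is a choice from the
  set of derivatives, and functions that agree near \<open>x\<close> have the same set.\<close>

lemma frechet_derivative_cong_open:
  assumes "open S" "x \<in> S" "\<And>y. y \<in> S \<Longrightarrow> f y = g y" 
  shows "frechet_derivative f (at x) = frechet_derivative g (at x)"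
proof -
  have "(f has_derivative f') (at x) \<longleftrightarrow> (g has_derivative f') (at x)" for f'
    using assms has_derivative_transform_within_open[of f f' x UNIV S g]
      has_derivative_transform_within_open[of g f' x UNIV S f] by auto
  then show ?thesis by (simp add: frechet_derivative_def)
qed

lemma Ck_on_cong:
  assumes "open S" "\<And>x. x \<in> S \<Longrightarrow> f x = g x" "Ck_on k S f"
  shows "Ck_on k S g"
  using assms(2,3)
proof (induction k arbitrary: f g)
  case 0
  then show ?case by (metis Ck_on.simps(1) continuous_on_cong)
next
  case (Suc k)
  have "g differentiable (at x)" if "x \<in> S" for x
    using Suc.prems that assms(1) unfolding differentiable_def
    by (metis Ck_on.simps(2) differentiable_def has_derivative_transform_within_open)
  moreover have "Ck_on k S (\<lambda>x. frechet_derivative g (at x) v)" for v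
    by (rule Suc.IH[of "\<lambda>x. frechet_derivative f (at x) v"])
      (use Suc.prems frechet_derivative_cong_open[OF assms(1), of _ f g] in auto)
  ultimately show ?case by simp
qed

lemma Ck_on_subset: "Ck_on k S f \<Longrightarrow> T \<subseteq> S \<Longrightarrow> Ck_on k T f"
  by (induction k arbitrary: f) (auto intro: continuous_on_subset)

lemma Ck_on_SucD: "Ck_on (Suc k) S f \<Longrightarrow> Ck_on k S f"
proof (induction k arbitrary: f)
  case 0
  then show ?case
    by (auto intro: continuous_at_imp_continuous_on differentiable_imp_continuous_within)
qed auto

lemma Ck_on_const: "Ck_on k S (\<lambda>x. c)"
  by (induction k arbitrary: c) auto

text \<open>Lets an explicit derivative \<open>f'\<close> take the place of the chosen
  \<open>frechet_derivative\<close> in the recursion.\<close>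

lemma Ck_on_SucI:
  assumes "open S" "\<And>x. x \<in> S \<Longrightarrow> (f has_derivative f' x) (at x)"
    and "\<And>v. Ck_on k S (\<lambda>x. f' x v)"
  shows "Ck_on (Suc k) S f"
proof -
  have "Ck_on k S (\<lambda>x. frechet_derivative f (at x) v)" for v
    by (rule Ck_on_cong[OF assms(1) _ assms(3)[of v]]) (simp add: frechet_derivative_eqI[OF assms(2)])
  then show ?thesis using assms(2) by (auto simp: differentiable_def)
qed

lemma Ck_on_Suc_has_derivative:
  "Ck_on (Suc k) S f \<Longrightarrow> x \<in> S \<Longrightarrow> (f has_derivative frechet_derivative f (at x)) (at x)"
  by (simp add: frechet_derivative_works)

lemma Ck_on_bounded_linear:
  assumes "open S" "bounded_linear L"
  shows "Ck_on k S L"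
proof (cases k)
  case 0
  then show ?thesis using assms linear_continuous_on by auto
next
  case (Suc n)
  then show ?thesis
    using Ck_on_SucI[OF assms(1), of L "\<lambda>_. L"] bounded_linear_imp_has_derivative[OF assms(2)]
      Ck_on_const by blast
qed

lemma Ck_on_add:
  assumes "open S" "Ck_on k S f" "Ck_on k S g"
  shows "Ck_on k S (\<lambda>x. f x + g x)"
  using assms(2,3)
proof (induction k arbitrary: f g)
  case (Suc k)
  show ?case
    by (rule Ck_on_SucI[OF assms(1) has_derivative_add[OF Ck_on_Suc_has_derivative[OF Suc.prems(1)]
            Ck_on_Suc_has_derivative[OF Suc.prems(2)]]])
      (use Suc in auto)
qed (auto intro: continuous_on_add)

lemma Ck_on_sum:
  assumes "open S" "\<And>i. i \<in> J \<Longrightarrow> Ck_on k S (f i)"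
  shows "Ck_on k S (\<lambda>x. \<Sum>i\<in>J. f i x)"
  using assms(2)
  by (induction J rule: infinite_finite_induct) (auto intro: Ck_on_const Ck_on_add[OF assms(1)])

lemma Ck_on_linear_comp:
  assumes "open S" "bounded_linear L" "Ck_on k S f"
  shows "Ck_on k S (\<lambda>x. L (f x))"
  using assms(3)
proof (induction k arbitrary: f)
  case 0
  then show ?case using assms by (auto intro: linear_continuous_on_compose bounded_linear.continuous_on)
next
  case (Suc k)
  show ?case
    by (rule Ck_on_SucI[OF assms(1) bounded_linear.has_derivative[OF assms(2)
            Ck_on_Suc_has_derivative[OF Suc.prems(1)]]])
      (use Suc in auto)
qed

lemma Ck_on_Pair:
  assumes "open S" "Ck_on k S f" "Ck_on k S g"
  shows "Ck_on k S (\<lambda>x. (f x, g x))"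
  using assms(2,3)
proof (induction k arbitrary: f g)
  case (Suc k)
  show ?case
    by (rule Ck_on_SucI[OF assms(1) has_derivative_Pair[OF Ck_on_Suc_has_derivative[OF Suc.prems(1)]
            Ck_on_Suc_has_derivative[OF Suc.prems(2)]]])
      (use Suc in auto)
qed (auto intro: continuous_on_Pair)

lemma Ck_on_scaleR:
  assumes "open S" "Ck_on k S f" "Ck_on k S g"
  shows "Ck_on k S (\<lambda>x. f x *\<^sub>R g x)"
  using assms(2,3)
proof (induction k arbitrary: f g)
  case (Suc k)
  have "Ck_on k S f" "Ck_on k S g" using Ck_on_SucD Suc.prems by blast+
  then show ?case
    by (intro Ck_on_SucI[OF assms(1) has_derivative_scaleR[OF Ck_on_Suc_has_derivative[OF Suc.prems(1)]
            Ck_on_Suc_has_derivative[OF Suc.prems(2)]]] Ck_on_add[OF assms(1)])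
      (use Suc in auto)
qed (auto intro: continuous_on_scaleR)

text \<open>In the chain rule the outer derivative is applied to the moving direction
  \<open>frechet_derivative g (at x) v\<close>. Expanding this direction in the frame leaves outer
  derivatives in fixed directions \<open>b\<close>, to which the induction hypothesis applies, and
  scalar coefficients of class C^k.\<close>

lemma Ck_on_compose:
  fixes g :: "'a::real_normed_vector \<Rightarrow> 'b::real_inner"
  assumes E: "parseval_frame (E :: 'b set)" and S: "open S"
    and "Ck_on k S g" "Ck_on k T f" "g ` S \<subseteq> T"
  shows "Ck_on k S (\<lambda>x. f (g x))"
  using assms(3,4)
proof (induction k arbitrary: f)
  case 0
  then show ?case using assms(5) by (auto intro: continuous_on_compose2)
next
  case (Suc k)
  have *: "Ck_on k S (\<lambda>x. \<Sum>b\<in>E. inner (frechet_derivative g (at x) v) b *\<^sub>R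
     frechet_derivative f (at (g x)) b)" for v
  proof (intro Ck_on_sum[OF S] Ck_on_scaleR[OF S] Ck_on_linear_comp[OF S bounded_linear_inner_left])
    fix b
    show "Ck_on k S (\<lambda>x. frechet_derivative g (at x) v)"
      using Suc.prems(1) by simp
    show "Ck_on k S (\<lambda>x. frechet_derivative f (at (g x)) b)"
      by (rule Suc.IH[OF Ck_on_SucD[OF Suc.prems(1)]]) (use Suc.prems(2) in simp)
  qed
  have g: "(g has_derivative frechet_derivative g (at x)) (at x)" if "x \<in> S" for x
    using Ck_on_Suc_has_derivative[OF Suc.prems(1) that] .
  have f: "(f has_derivative frechet_derivative f (at (g x))) (at (g x))" if "x \<in> S" for x
    using Ck_on_Suc_has_derivative[OF Suc.prems(2)] that assms(5) by blast
  show ?case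
  proof (rule Ck_on_SucI[OF S has_derivative_compose[OF g f]])
    fix v
    show "Ck_on k S (\<lambda>x. frechet_derivative f (at (g x)) (frechet_derivative g (at x) v))"
    proof (rule Ck_on_cong[OF S _ *[of v]])
      fix x assume "x \<in> S"
      then interpret bounded_linear "frechet_derivative f (at (g x))"
        using f has_derivative_bounded_linear by blast
      have "frechet_derivative f (at (g x)) (frechet_derivative g (at x) v)
        = frechet_derivative f (at (g x)) (\<Sum>b\<in>E. inner (frechet_derivative g (at x) v) b *\<^sub>R b)"
        by (simp only: parseval_frameD(3)[OF E])
      then show "(\<Sum>b\<in>E. inner (frechet_derivative g (at x) v) b *\<^sub>R frechet_derivative f (at (g x)) b)
        = frechet_derivative f (at (g x)) (frechet_derivative g (at x) v)"
        by (simp add: sum scaleR)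
    qed
  qed
qed

lemma Ck_on_local:
  assumes "\<And>x. x \<in> S \<Longrightarrow> \<exists>U. open U \<and> x \<in> U \<and> Ck_on k U f"
  shows "Ck_on k S f"
  using assms
proof (induction k arbitrary: f)
  case 0
  have "isCont f x" if x: "x \<in> S" for x
    using 0[OF x] continuous_on_eq_continuous_at by auto
  then show ?case by (simp add: continuous_at_imp_continuous_on)
next
  case (Suc k)
  have "f differentiable (at x)" if "x \<in> S" for x using Suc.prems[OF that] by auto
  moreover have "Ck_on k S (\<lambda>x. frechet_derivative f (at x) v)" for v
    by (rule Suc.IH) (use Suc.prems in fastforce)
  ultimately show ?case by simp
qed

lemma smooth_on_has_derivative:
  "smooth_on S f \<Longrightarrow> x \<in> S \<Longrightarrow> (f has_derivative frechet_derivative f (at x)) (at x)"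
  unfolding smooth_on_def using Ck_on_Suc_has_derivative by blast

lemma smooth_on_frechet_derivative: 
  "smooth_on S f \<Longrightarrow> smooth_on S (\<lambda>x. frechet_derivative f (at x) v)"
  unfolding smooth_on_def by (metis Ck_on.simps(2))

lemma smooth_on_continuous: "smooth_on S f \<Longrightarrow> continuous_on S f"
  unfolding smooth_on_def by (metis Ck_on.simps(1))

lemma smooth_on_cong: "smooth_on S f \<Longrightarrow> open S \<Longrightarrow> (\<And>x. x \<in> S \<Longrightarrow> f x = g x) \<Longrightarrow> smooth_on S g"
  unfolding smooth_on_def using Ck_on_cong by blast

lemma smooth_on_subset: "smooth_on S f \<Longrightarrow> T \<subseteq> S \<Longrightarrow> smooth_on T f"
  unfolding smooth_on_def using Ck_on_subset by blast

lemma smooth_on_const: "smooth_on S (\<lambda>x. c)"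
  unfolding smooth_on_def using Ck_on_const by blast

lemma smooth_on_bounded_linear: "open S \<Longrightarrow> bounded_linear L \<Longrightarrow> smooth_on S L"
  unfolding smooth_on_def using Ck_on_bounded_linear by blast

lemma smooth_on_id: "open S \<Longrightarrow> smooth_on S (\<lambda>x. x)"
  by (rule smooth_on_bounded_linear) (auto simp: bounded_linear_ident)

lemma smooth_on_linear_comp:
  "open S \<Longrightarrow> bounded_linear L \<Longrightarrow> smooth_on S f \<Longrightarrow> smooth_on S (\<lambda>x. L (f x))"
  unfolding smooth_on_def using Ck_on_linear_comp by blast

lemma smooth_on_add: "open S \<Longrightarrow> smooth_on S f \<Longrightarrow> smooth_on S g \<Longrightarrow> smooth_on S (\<lambda>x. f x + g x)"
  unfolding smooth_on_def using Ck_on_add by blast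

lemma smooth_on_sum:
  "open S \<Longrightarrow> (\<And>i. i \<in> J \<Longrightarrow> smooth_on S (f i)) \<Longrightarrow> smooth_on S (\<lambda>x. \<Sum>i\<in>J. f i x)"
  unfolding smooth_on_def by (simp add: Ck_on_sum)

lemma smooth_on_Pair:
  "open S \<Longrightarrow> smooth_on S f \<Longrightarrow> smooth_on S g \<Longrightarrow> smooth_on S (\<lambda>x. (f x, g x))"
  unfolding smooth_on_def using Ck_on_Pair by blast

lemma smooth_on_compose:
  fixes g :: "'a::real_normed_vector \<Rightarrow> 'b::real_inner"
  assumes "parseval_frame (E :: 'b set)" "open S" "smooth_on S g" "smooth_on T f" "g ` S \<subseteq> T"
  shows "smooth_on S (\<lambda>x. f (g x))"
  unfolding smooth_on_def
proof
  fix k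
  show "Ck_on k S (\<lambda>x. f (g x))"
    by (rule Ck_on_compose[OF assms(1,2) _ _ assms(5)]) (use assms(3,4) in \<open>auto simp: smooth_on_def\<close>)
qed

lemma smooth_on_local:
  assumes "\<And>x. x \<in> S \<Longrightarrow> \<exists>U. open U \<and> x \<in> U \<and> smooth_on U f"
  shows "smooth_on S f"
  unfolding smooth_on_def
proof
  fix k
  show "Ck_on k S f"
    by (rule Ck_on_local) (use assms in \<open>auto simp: smooth_on_def\<close>)
qed

section \<open>Symmetry of second derivatives\<close>

lemma mvt_line:
  fixes f :: "'a::real_normed_vector \<Rightarrow> real"
  assumes "h > 0" "\<And>t. 0 \<le> t \<Longrightarrow> t \<le> h \<Longrightarrow> (f has_derivative f' (p + t *\<^sub>R v)) (at (p + t *\<^sub>R v))"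
  obtains t where "0 < t" "t < h" "f (p + h *\<^sub>R v) - f p = h * f' (p + t *\<^sub>R v) v"
proof -
  have der: "((\<lambda>t. f (p + t *\<^sub>R v)) has_derivative (\<lambda>s. f' (p + t *\<^sub>R v) (s *\<^sub>R v))) (at t)"
    if "0 \<le> t" "t \<le> h" for t
    by (rule has_derivative_compose[where g = f]) (use assms(2)[OF that] in \<open>auto intro!: derivative_eq_intros\<close>)
  have "DERIV (\<lambda>t. f (p + t *\<^sub>R v)) t :> f' (p + t *\<^sub>R v) v" if "0 \<le> t" "t \<le> h" for t
  proof -
    interpret bounded_linear "f' (p + t *\<^sub>R v)"
      using assms(2)[OF that] has_derivative_bounded_linear by blast
    show ?thesis
      using der[OF that] by (auto simp: has_field_derivative_def scaleR mult.commute elim!: has_derivative_eq_rhs)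
  qed
  from MVT2[OF assms(1), of "\<lambda>t. f (p + t *\<^sub>R v)", OF this]
  show ?thesis using that by auto
qed

text \<open>Both mixed derivatives occur as values of the second difference quotient by two applications
  of the mean value theorem, at intermediate points near \<open>x\<close>.\<close>

lemma second_difference:
  fixes f :: "'a::real_normed_vector \<Rightarrow> real"
  assumes f: "smooth_on (ball x r) f" and h: "h > 0" "h * (norm v + norm w) < r"
  obtains p where
    "f (x + h *\<^sub>R v + h *\<^sub>R w) - f (x + h *\<^sub>R v) - f (x + h *\<^sub>R w) + f x
      = h * h * frechet_derivative (\<lambda>y. frechet_derivative f (at y) v) (at p) w"
    "dist x p \<le> h * (norm v + norm w)"
proof -
  let ?D = "\<lambda>y. frechet_derivative f (at y)"
  have in_ball: "dist x (x + s *\<^sub>R v + t *\<^sub>R w) \<le> h * (norm v + norm w)"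
    if "0 \<le> s" "s \<le> h" "0 \<le> t" "t \<le> h" for s t
  proof -
    have "x - (x + s *\<^sub>R v + t *\<^sub>R w) = - (s *\<^sub>R v + t *\<^sub>R w)"
      by simp
    then have "dist x (x + s *\<^sub>R v + t *\<^sub>R w) = norm (s *\<^sub>R v + t *\<^sub>R w)"
      by (simp only: dist_norm norm_minus_cancel)
    also have "\<dots> \<le> s * norm v + t * norm w"
      using norm_triangle_ineq[of "s *\<^sub>R v" "t *\<^sub>R w"] that by simp
    also have "\<dots> \<le> h * (norm v + norm w)"
      using that by (auto simp: distrib_left intro!: add_mono mult_right_mono)
    finally show ?thesis .
  qed
  have df: "(f has_derivative ?D y) (at y)" if "dist x y \<le> h * (norm v + norm w)" for y
    using smooth_on_has_derivative[OF f] that h by auto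
  have dd: "((\<lambda>y. ?D y v) has_derivative frechet_derivative (\<lambda>y. ?D y v) (at y)) (at y)"
    if "dist x y \<le> h * (norm v + norm w)" for y
    using smooth_on_has_derivative[OF smooth_on_frechet_derivative[OF f]] that h by auto
  \<comment> \<open>The increment in direction \<open>w\<close> is kept fixed while the base point
    moves along \<open>v\<close>; the second application then freezes the direction \<open>v\<close>
    and moves along \<open>w\<close>.\<close>
  have "((\<lambda>y. f (y + h *\<^sub>R w) - f y) has_derivative
      (\<lambda>u. ?D (x + s *\<^sub>R v + h *\<^sub>R w) u - ?D (x + s *\<^sub>R v) u)) (at (x + s *\<^sub>R v))"
    if "0 \<le> s" "s \<le> h" for s
  proof (intro has_derivative_diff df)
    have "((\<lambda>y. y + h *\<^sub>R w) has_derivative (\<lambda>u. u)) (at (x + s *\<^sub>R v))"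
      by (auto intro!: derivative_eq_intros)
    then show "((\<lambda>y. f (y + h *\<^sub>R w)) has_derivative ?D (x + s *\<^sub>R v + h *\<^sub>R w)) (at (x + s *\<^sub>R v))"
      by (rule has_derivative_compose[where g = f]) (use df[OF in_ball[OF that, of h]] h in simp)
    show "dist x (x + s *\<^sub>R v) \<le> h * (norm v + norm w)"
      using in_ball[OF that, of 0] h by simp
  qed
  then obtain s where s: "0 < s" "s < h" "f (x + h *\<^sub>R v + h *\<^sub>R w) - f (x + h *\<^sub>R v) - (f (x + h *\<^sub>R w) - f x)
     = h * (?D (x + s *\<^sub>R v + h *\<^sub>R w) v - ?D (x + s *\<^sub>R v) v)"
    by (rule mvt_line[OF h(1), of "\<lambda>y. f (y + h *\<^sub>R w) - f y" "\<lambda>y u. ?D (y + h *\<^sub>R w) u - ?D y u" x v])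
  have "((\<lambda>y. ?D y v) has_derivative frechet_derivative (\<lambda>y. ?D y v) (at (x + s *\<^sub>R v + t *\<^sub>R w)))
     (at (x + s *\<^sub>R v + t *\<^sub>R w))" if "0 \<le> t" "t \<le> h" for t
    using in_ball[of s t] that s by (intro dd) auto
  then obtain t where t: "0 < t" "t < h" "?D (x + s *\<^sub>R v + h *\<^sub>R w) v - ?D (x + s *\<^sub>R v) v
    = h * frechet_derivative (\<lambda>y. ?D y v) (at (x + s *\<^sub>R v + t *\<^sub>R w)) w"
    by (rule mvt_line[OF h(1), of "\<lambda>y. ?D y v" "\<lambda>y. frechet_derivative (\<lambda>y. ?D y v) (at y)" "x + s *\<^sub>R v" w])
  show ?thesis
    using that[of "x + s *\<^sub>R v + t *\<^sub>R w"] in_ball[of s t] s t h by auto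
qed

text \<open>The second difference is symmetric in \<open>v\<close> and \<open>w\<close>, so the two
  mixed derivatives take a common value at points \<open>p\<close> and \<open>q\<close> as close to
  \<open>x\<close> as desired. Continuity of both then excludes different values at
  \<open>x\<close>.\<close>

lemma mixed_derivatives_eq_real:
  fixes f :: "'a::real_normed_vector \<Rightarrow> real"
  assumes f: "smooth_on S f" and S: "open S" "x \<in> S"
  shows "frechet_derivative (\<lambda>y. frechet_derivative f (at y) v) (at x) w
       = frechet_derivative (\<lambda>y. frechet_derivative f (at y) w) (at x) v" (is "?P v w x = ?P w v x")
proof (rule ccontr)
  assume ne: "?P v w x \<noteq> ?P w v x"
  obtain r where r: "r > 0" "ball x r \<subseteq> S" using S openE by blast
  have cont: "isCont (?P v w) x" for v w
    using smooth_on_continuous[OF smooth_on_frechet_derivative[OF smooth_on_frechet_derivative[OF f]]]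
      S continuous_on_eq_continuous_at by blast
  define e where "e = dist (?P v w x) (?P w v x) / 2"
  have "e > 0" using ne by (simp add: e_def)
  obtain d1 where d1: "d1 > 0" "\<And>p. dist p x < d1 \<Longrightarrow> dist (?P v w p) (?P v w x) < e"
    using cont[of v w] \<open>e > 0\<close> unfolding continuous_at_eps_delta by blast
  obtain d2 where d2: "d2 > 0" "\<And>p. dist p x < d2 \<Longrightarrow> dist (?P w v p) (?P w v x) < e"
    using cont[of w v] \<open>e > 0\<close> unfolding continuous_at_eps_delta by blast
  define d where "d = min r (min d1 d2)"
  \<comment> \<open>Chosen so that \<open>h * (norm v + norm w) < d\<close>; the summand
    \<open>1\<close> keeps the denominator positive when both vectors vanish.\<close>
  define h where "h = d / (norm v + norm w + 1)"
  have d: "d > 0" "d \<le> r" "d \<le> d1" "d \<le> d2" using r d1 d2 by (auto simp: d_def)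
  have n: "norm v + norm w + 1 > 0" using norm_ge_zero[of v] norm_ge_zero[of w] by linarith
  have h: "h > 0" using d n by (simp add: h_def)
  have "h * (norm v + norm w) < h * (norm v + norm w + 1)" using h by simp
  also have "\<dots> = d" using n by (simp add: h_def)
  finally have hd: "h * (norm v + norm w) < d" .
  have hr: "h * (norm v + norm w) < r" "h * (norm w + norm v) < r" using hd d by (auto simp: add.commute)
  have fb: "smooth_on (ball x r) f" using smooth_on_subset[OF f] r by blast
  obtain p where p: "f (x + h *\<^sub>R v + h *\<^sub>R w) - f (x + h *\<^sub>R v) - f (x + h *\<^sub>R w) + f x
      = h * h * ?P v w p" "dist x p \<le> h * (norm v + norm w)"
    by (rule second_difference[OF fb h hr(1)])
  obtain q where q: "f (x + h *\<^sub>R w + h *\<^sub>R v) - f (x + h *\<^sub>R w) - f (x + h *\<^sub>R v) + f x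
      = h * h * ?P w v q" "dist x q \<le> h * (norm w + norm v)"
    by (rule second_difference[OF fb h hr(2)])
  have "h * h * ?P v w p = h * h * ?P w v q"
    using p(1) q(1) by (simp add: algebra_simps)
  then have "?P v w p = ?P w v q" using h by simp
  moreover have "dist (?P v w p) (?P v w x) < e" "dist (?P w v q) (?P w v x) < e"
    using d1(2)[of p] d2(2)[of q] p q hd d by (auto simp: dist_commute add.commute)
  ultimately show False
    unfolding e_def dist_real_def by (smt (verit) field_sum_of_halves)
qed

text \<open>Inner products with fixed vectors commute with differentiation and separate points,
  which reduces the claim to real-valued functions.\<close>

lemma mixed_derivatives_eq:
  fixes f :: "'a::real_normed_vector \<Rightarrow> 'b::real_inner"
  assumes f: "smooth_on S f" and S: "open S" "x \<in> S"
  shows "frechet_derivative (\<lambda>y. frechet_derivative f (at y) v) (at x) w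
       = frechet_derivative (\<lambda>y. frechet_derivative f (at y) w) (at x) v"
proof -
  have *: "frechet_derivative (\<lambda>y. inner (h y) c) (at y) u = inner (frechet_derivative h (at y) u) c"
    if "smooth_on S h" "y \<in> S" for h :: "'a \<Rightarrow> 'b" and c y u
    using frechet_derivative_eqI[OF bounded_linear.has_derivative[OF bounded_linear_inner_left
          smooth_on_has_derivative[OF that]]] by (simp add: fun_eq_iff)
  have "inner (frechet_derivative (\<lambda>y. frechet_derivative f (at y) v) (at x) w) c
     = frechet_derivative (\<lambda>y. frechet_derivative (\<lambda>y. inner (f y) c) (at y) v) (at x) w" for v w c
  proof -
    have "frechet_derivative (\<lambda>y. frechet_derivative (\<lambda>y. inner (f y) c) (at y) v) (at x)
      = frechet_derivative (\<lambda>y. inner (frechet_derivative f (at y) v) c) (at x)"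
      by (rule frechet_derivative_cong_open[OF S]) (simp add: *[OF f])
    then show ?thesis
      using *[OF smooth_on_frechet_derivative[OF f] S(2)] by simp
  qed
  moreover have "frechet_derivative (\<lambda>y. frechet_derivative (\<lambda>y. inner (f y) c) (at y) v) (at x) w
    = frechet_derivative (\<lambda>y. frechet_derivative (\<lambda>y. inner (f y) c) (at y) w) (at x) v" for c
    by (rule mixed_derivatives_eq_real[OF smooth_on_linear_comp[OF S(1) bounded_linear_inner_left f] S])
  ultimately have "inner (frechet_derivative (\<lambda>y. frechet_derivative f (at y) v) (at x) w) c
    = inner (frechet_derivative (\<lambda>y. frechet_derivative f (at y) w) (at x) v) c" for c
    by simp
  then show ?thesis using vector_eq_rdot by blast
qed

text \<open>A product rule for a derivative whose base point and direction both depend on the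
  parameter; it is used for the adjoint action along a flow. The frame again replaces the moving
  direction by fixed ones.\<close>

lemma has_derivative_frechet_derivative:
  fixes f :: "'a::real_inner \<Rightarrow> 'b::real_normed_vector" and p :: "'c::real_normed_vector \<Rightarrow> 'a"
  assumes E: "parseval_frame (E :: 'a set)" and f: "smooth_on S f" and S: "open S" "p t \<in> S"
    and p: "(p has_derivative p') (at t)" and w: "(w has_derivative w') (at t)"
  shows "((\<lambda>s. frechet_derivative f (at (p s)) (w s)) has_derivative
    (\<lambda>h. frechet_derivative (\<lambda>y. frechet_derivative f (at y) (w t)) (at (p t)) (p' h)
       + frechet_derivative f (at (p t)) (w' h))) (at t)"
proof -
  let ?D = "\<lambda>y. frechet_derivative f (at y)"
  have expand: "?D y v = (\<Sum>b\<in>E. inner v b *\<^sub>R ?D y b)" if "y \<in> S" for y v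
  proof -
    interpret D: bounded_linear "?D y"
      using smooth_on_has_derivative[OF f that] by (rule has_derivative_bounded_linear)
    have "?D y v = ?D y (\<Sum>b\<in>E. inner v b *\<^sub>R b)" by (simp only: parseval_frameD(3)[OF E])
    then show ?thesis by (simp add: D.sum D.scaleR)
  qed
  have Db: "((\<lambda>y. ?D y b) has_derivative frechet_derivative (\<lambda>y. ?D y b) (at (p t))) (at (p t))" for b
    by (rule smooth_on_has_derivative[OF smooth_on_frechet_derivative[OF f] S(2)])
  have "((\<lambda>y. \<Sum>b\<in>E. inner (w t) b *\<^sub>R ?D y b) has_derivative
     (\<lambda>k. \<Sum>b\<in>E. inner (w t) b *\<^sub>R frechet_derivative (\<lambda>y. ?D y b) (at (p t)) k)) (at (p t))"
    by (intro has_derivative_sum has_derivative_scaleR_right Db)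
  then have "((\<lambda>y. ?D y (w t)) has_derivative
     (\<lambda>k. \<Sum>b\<in>E. inner (w t) b *\<^sub>R frechet_derivative (\<lambda>y. ?D y b) (at (p t)) k)) (at (p t))"
    by (rule has_derivative_transform_within_open[OF _ S]) (simp add: expand)
  \<comment> \<open>With the direction frozen at \<open>w t\<close>, the frame sum is recognised as
    the second derivative that occurs in the claim.\<close>
  note second = frechet_derivative_eqI[OF this]
  have "continuous (at t) p" using p by (rule has_derivative_continuous)
  then obtain T where T: "open T" "t \<in> T" "\<And>s. s \<in> T \<Longrightarrow> p s \<in> S"
    using S unfolding continuous_at_open by metis
  have "((\<lambda>s. \<Sum>b\<in>E. inner (w s) b *\<^sub>R ?D (p s) b) has_derivative
    (\<lambda>h. \<Sum>b\<in>E. inner (w t) b *\<^sub>R frechet_derivative (\<lambda>y. ?D y b) (at (p t)) (p' h)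
       + inner (w' h) b *\<^sub>R ?D (p t) b)) (at t)"
    by (intro has_derivative_sum has_derivative_scaleR has_derivative_compose[OF p Db]
        bounded_linear.has_derivative[OF bounded_linear_inner_left] w)
  then have "((\<lambda>s. ?D (p s) (w s)) has_derivative
    (\<lambda>h. \<Sum>b\<in>E. inner (w t) b *\<^sub>R frechet_derivative (\<lambda>y. ?D y b) (at (p t)) (p' h)
       + inner (w' h) b *\<^sub>R ?D (p t) b)) (at t)"
    by (rule has_derivative_transform_within_open[OF _ T(1,2)]) (simp add: expand T(3))
  then show ?thesis
    by (rule has_derivative_eq_rhs) (simp add: second sum.distrib expand[OF S(2), of "w' _"])
qed

section \<open>Ordinary differential equations\<close>

lemma vector_derivative_bound:
  fixes f :: "real \<Rightarrow> 'a::real_normed_vector"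
  assumes "convex S" "\<And>t. t \<in> S \<Longrightarrow> (f has_vector_derivative f' t) (at t within S)"
    and "\<And>t. t \<in> S \<Longrightarrow> norm (f' t) \<le> B" "s \<in> S" "t \<in> S"
  shows "norm (f s - f t) \<le> B * \<bar>s - t\<bar>"
proof -
  have "norm (f s - f t) \<le> B * norm (s - t)"
  proof (rule differentiable_bound[OF assms(1), where f' = "\<lambda>t h. h *\<^sub>R f' t"])
    show "onorm (\<lambda>h. h *\<^sub>R f' u) \<le> B" if "u \<in> S" for u
      using assms(3)[OF that] by (intro onorm_le) (simp add: mult_left_mono mult.commute[of B])
  qed (use assms in \<open>auto simp: has_vector_derivative_def\<close>)
  then show ?thesis by simp
qed

text \<open>Type inference does not derive the class \<open>banach\<close> from \<open>real_inner\<close> and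
  \<open>complete_space\<close>, so the library's integral is applied coordinatewise.\<close>

lemma antiderivative_exists:
  fixes f :: "real \<Rightarrow> 'a::real_inner"
  assumes E: "parseval_frame (E :: 'a set)" and f: "continuous_on {a..b} f"
  obtains F where "\<And>t. t \<in> {a..b} \<Longrightarrow> (F has_vector_derivative f t) (at t within {a..b})"
proof -
  have "\<exists>G. \<forall>t\<in>{a..b}. (G has_vector_derivative inner (f t) c) (at t within {a..b})" for c
  proof -
    have "continuous_on {a..b} (\<lambda>t. inner (f t) c)"
      using f by (intro continuous_intros)
    then obtain G where "\<And>t. t \<in> {a..b} \<Longrightarrow> (G has_vector_derivative inner (f t) c) (at t within {a..b})"
      using antiderivative_continuous by metis
    then show ?thesis by blast
  qed
  then obtain G where G: "\<And>c t. t \<in> {a..b} \<Longrightarrow> (G c has_vector_derivative inner (f t) c) (at t within {a..b})"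
    by metis
  have "((\<lambda>t. \<Sum>c\<in>E. G c t *\<^sub>R c) has_vector_derivative f t) (at t within {a..b})" if "t \<in> {a..b}" for t
  proof -
    have "((\<lambda>t. \<Sum>c\<in>E. G c t *\<^sub>R c) has_vector_derivative (\<Sum>c\<in>E. inner (f t) c *\<^sub>R c)) (at t within {a..b})"
      by (intro has_vector_derivative_sum bounded_linear.has_vector_derivative[OF bounded_linear_scaleR_left G[OF that]])
    then show ?thesis by (simp add: parseval_frameD(3)[OF E])
  qed
  then show ?thesis using that by blast
qed

definition lipschitz_bound :: "real \<Rightarrow> 'a::real_normed_vector set \<Rightarrow> ('a \<Rightarrow> 'b::real_normed_vector) \<Rightarrow> bool" where
  "lipschitz_bound L K X \<longleftrightarrow> 0 \<le> L \<and> (\<forall>x\<in>K. \<forall>y\<in>K. norm (X x - X y) \<le> L * norm (x - y))"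

text \<open>The Picard operator is a contraction on the bounded continuous functions from the whole
  line into the closed ball. These form a complete set, and clamping time to the interval makes the
  operator act on them.\<close>

lemma picard_existence:
  fixes X :: "'a::{real_inner,complete_space} \<Rightarrow> 'a"
  assumes E: "parseval_frame (E :: 'a set)" and r: "r > 0" and X: "lipschitz_bound L (cball x0 r) X"
  obtains \<epsilon> \<gamma> where "\<epsilon> > 0" "\<gamma> 0 = x0" "\<And>t. t \<in> {-\<epsilon>..\<epsilon>} \<Longrightarrow> \<gamma> t \<in> cball x0 r"
    "\<And>t. t \<in> {-\<epsilon>..\<epsilon>} \<Longrightarrow> (\<gamma> has_vector_derivative X (\<gamma> t)) (at t within {-\<epsilon>..\<epsilon>})"
proof -
  let ?K = "cball x0 r"
  have L: "L \<ge> 0" and Lip: "\<And>x y. x \<in> ?K \<Longrightarrow> y \<in> ?K \<Longrightarrow> norm (X x - X y) \<le> L * norm (x - y)"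
    using X by (auto simp: lipschitz_bound_def)
  \<comment> \<open>A bound for \<open>norm (X x)\<close> on the ball, by the Lipschitz estimate
    from the centre.\<close>
  define M where "M = norm (X x0) + L * r"
  have M: "M \<ge> 0" using L r by (simp add: M_def)
  \<comment> \<open>The first bound gives \<open>M * \<epsilon> \<le> r\<close>, so that curves stay
    in the ball; the second gives \<open>L * \<epsilon> \<le> 1 / 2\<close>, the contraction factor.
    Adding \<open>1\<close> covers \<open>M = 0\<close> and \<open>L = 0\<close>.\<close>
  define \<epsilon> where "\<epsilon> = min (r / (M + 1)) (1 / (2 * (L + 1)))"
  have \<epsilon>: "\<epsilon> > 0" using r M L by (simp add: \<epsilon>_def)
  have "M * \<epsilon> \<le> (M + 1) * (r / (M + 1))"
    using M \<epsilon> by (intro mult_mono) (auto simp: \<epsilon>_def)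
  then have M\<epsilon>: "M * \<epsilon> \<le> r" using M by simp
  have "L * \<epsilon> \<le> (L + 1) * (1 / (2 * (L + 1)))"
    using L \<epsilon> by (intro mult_mono) (auto simp: \<epsilon>_def)
  also have "\<dots> = 1 / 2" using L by (simp add: divide_simps)
  finally have L\<epsilon>: "L * \<epsilon> \<le> 1 / 2" .
  let ?I = "{-\<epsilon>..\<epsilon>}"
  have XM: "norm (X x) \<le> M" if "x \<in> ?K" for x
  proof -
    have "norm (X x) \<le> norm (X x0) + norm (X x - X x0)"
      using norm_triangle_sub by blast
    also have "norm (X x - X x0) \<le> L * norm (x - x0)"
      using Lip that r by simp
    also have "\<dots> \<le> L * r"
      using that L by (intro mult_left_mono) (auto simp: dist_norm norm_minus_commute)
    finally show ?thesis by (simp add: M_def)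
  qed
  have contX: "continuous_on ?K X"
    using Lip L by (intro lipschitz_on_continuous_on[of L] lipschitz_onI) (auto simp: dist_norm)
  define S where "S = (PiC UNIV (\<lambda>_. ?K) :: (real \<Rightarrow>\<^sub>C 'a) set)"
  have S_iff: "f \<in> S \<longleftrightarrow> (\<forall>t. apply_bcontfun f t \<in> ?K)" for f
    by (auto simp: S_def mem_PiC_iff)
  have "\<exists>F. F 0 = 0 \<and> (\<forall>t\<in>?I. (F has_vector_derivative X (apply_bcontfun f t)) (at t within ?I))"
    if "f \<in> S" for f
  proof -
    have "continuous_on ?I (\<lambda>t. X (apply_bcontfun f t))"
      using that by (intro continuous_on_compose2[OF contX]) (auto simp: S_iff intro: continuous_intros)
    then obtain F where F: "\<And>t. t \<in> ?I \<Longrightarrow> (F has_vector_derivative X (apply_bcontfun f t)) (at t within ?I)"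
      using antiderivative_exists[OF E] by metis
    then have "\<forall>t\<in>?I. ((\<lambda>t. F t - F 0) has_vector_derivative X (apply_bcontfun f t)) (at t within ?I)"
      by (auto intro!: derivative_eq_intros)
    then show ?thesis by (intro exI[of _ "\<lambda>t. F t - F 0"]) auto
  qed
  then obtain F where F0: "\<And>f. f \<in> S \<Longrightarrow> F f 0 = 0"
    and F: "\<And>f t. f \<in> S \<Longrightarrow> t \<in> ?I \<Longrightarrow> (F f has_vector_derivative X (apply_bcontfun f t)) (at t within ?I)"
    by metis
  have F_bound: "norm (F f t) \<le> r" if "f \<in> S" "t \<in> ?I" for f t
  proof -
    have "norm (F f t - F f 0) \<le> M * \<bar>t - 0\<bar>"
      using that \<epsilon> F XM by (intro vector_derivative_bound[of ?I]) (auto simp: S_iff)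
    also have "\<dots> \<le> M * \<epsilon>" using that M by (intro mult_left_mono) auto
    finally show ?thesis using M\<epsilon> F0 that by simp
  qed
  \<comment> \<open>Retraction of the line onto the interval: a function on the interval becomes one
    on the whole line that is constant beyond each end.\<close>
  define p where "p = (\<lambda>t. max (-\<epsilon>) (min \<epsilon> t))"
  have p: "p t \<in> ?I" for t using \<epsilon> by (auto simp: p_def)
  have pI: "p t = t" if "t \<in> ?I" for t using that by (auto simp: p_def)
  define T where "T = (\<lambda>f. Bcontfun (\<lambda>t. x0 + F f (p t)))"
  have T: "apply_bcontfun (T f) t = x0 + F f (p t)" if f: "f \<in> S" for f t
  proof -
    have "continuous_on ?I (F f)"
      using F[OF f] by (rule continuous_on_vector_derivative)
    moreover have "continuous_on UNIV p"
      unfolding p_def by (intro continuous_intros)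
    ultimately have "continuous_on UNIV (\<lambda>t. F f (p t))"
      using p by (intro continuous_on_compose2[of ?I "F f" UNIV p]) auto
    then have "continuous_on UNIV (\<lambda>t. x0 + F f (p t))"
      by (intro continuous_intros)
    moreover have "norm (x0 + F f (p t)) \<le> norm x0 + r" for t
      using F_bound[OF f p[of t]] norm_triangle_ineq[of x0 "F f (p t)"] by linarith
    ultimately have "(\<lambda>t. x0 + F f (p t)) \<in> bcontfun"
      by (rule bcontfun_normI)
    then show ?thesis by (simp add: T_def Bcontfun_inverse)
  qed
  have TS: "T ` S \<subseteq> S"
    using F_bound p by (auto simp: S_iff[of "T _"] T dist_norm)
  have contr: "dist (T f) (T h) \<le> 1 / 2 * dist f h" if fh: "f \<in> S" "h \<in> S" for f h
  proof (rule dist_bound)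
    fix t
    have "norm ((F f (p t) - F h (p t)) - (F f 0 - F h 0)) \<le> (L * dist f h) * \<bar>p t - 0\<bar>"
    proof (rule vector_derivative_bound[of ?I "\<lambda>t. F f t - F h t"])
      fix s assume s: "s \<in> ?I"
      show "((\<lambda>t. F f t - F h t) has_vector_derivative X (apply_bcontfun f s) - X (apply_bcontfun h s)) (at s within ?I)"
        using F fh s by (intro has_vector_derivative_diff) auto
      have "norm (X (apply_bcontfun f s) - X (apply_bcontfun h s)) \<le> L * dist (apply_bcontfun f s) (apply_bcontfun h s)"
        using Lip fh by (simp add: S_iff dist_norm)
      also have "\<dots> \<le> L * dist f h"
        using L by (intro mult_left_mono dist_bounded)
      finally show "norm (X (apply_bcontfun f s) - X (apply_bcontfun h s)) \<le> L * dist f h" .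
    qed (use p \<epsilon> in auto)
    also have "\<dots> \<le> (L * dist f h) * \<epsilon>"
      using p[of t] L by (intro mult_left_mono) auto
    also have "\<dots> = (L * \<epsilon>) * dist f h" by simp
    also have "\<dots> \<le> 1 / 2 * dist f h" using L\<epsilon> by (intro mult_right_mono) auto
    finally show "dist (apply_bcontfun (T f) t) (apply_bcontfun (T h) t) \<le> 1 / 2 * dist f h"
      using fh by (simp add: T dist_norm F0)
  qed
  have "\<exists>!f. f \<in> S \<and> T f = f"
  proof (rule Banach_fix[of S "1/2" T])
    show "complete S"
      unfolding S_def by (simp add: complete_eq_closed closed_PiC)
    have "const_bcontfun x0 \<in> S" using r by (auto simp: S_iff)
    then show "S \<noteq> {}" by blast
  qed (use TS contr in auto)
  then obtain f where f: "f \<in> S" "T f = f" by blast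
  have ft: "apply_bcontfun f t = x0 + F f t" if "t \<in> ?I" for t
    using T[OF f(1), of t] f(2) pI[OF that] by simp
  show ?thesis
  proof (rule that[of \<epsilon> "apply_bcontfun f", OF \<epsilon>])
    show "apply_bcontfun f 0 = x0" using ft[of 0] F0 f \<epsilon> by simp
    show "apply_bcontfun f t \<in> ?K" if "t \<in> ?I" for t using f by (simp add: S_iff)
    show "(apply_bcontfun f has_vector_derivative X (apply_bcontfun f t)) (at t within ?I)" if t: "t \<in> ?I" for t
    proof (rule has_vector_derivative_transform[OF t])
      show "((\<lambda>t. x0 + F f t) has_vector_derivative X (apply_bcontfun f t)) (at t within ?I)"
        using F[OF f(1) t] by (auto intro!: derivative_eq_intros)
    qed (use ft in auto)
  qed
qed

text \<open>At a point \<open>s\<close> where the distance of the solutions is maximal, the mean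
  value estimate bounds this maximum by \<open>L * \<epsilon>\<close> times itself. As this factor
  is less than \<open>1\<close>, the maximum is zero.\<close>

lemma ode_solution_unique:
  fixes X :: "'a::real_normed_vector \<Rightarrow> 'a"
  assumes X: "lipschitz_bound L K X" and \<epsilon>: "0 \<le> \<epsilon>" "L * \<epsilon> < 1"
    and u: "\<And>t. t \<in> {-\<epsilon>..\<epsilon>} \<Longrightarrow> u t \<in> K \<and> (u has_vector_derivative X (u t)) (at t within {-\<epsilon>..\<epsilon>})"
    and v: "\<And>t. t \<in> {-\<epsilon>..\<epsilon>} \<Longrightarrow> v t \<in> K \<and> (v has_vector_derivative X (v t)) (at t within {-\<epsilon>..\<epsilon>})"
    and "u 0 = v 0" and t: "t \<in> {-\<epsilon>..\<epsilon>}"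
  shows "u t = v t"
proof -
  let ?I = "{-\<epsilon>..\<epsilon>}"
  define d where "d = (\<lambda>t. u t - v t)"
  have der: "(d has_vector_derivative X (u t) - X (v t)) (at t within ?I)" if "t \<in> ?I" for t
    unfolding d_def using u v that by (intro has_vector_derivative_diff) auto
  have "continuous_on ?I (\<lambda>t. norm (d t))"
    using continuous_on_vector_derivative[OF der] by (intro continuous_intros) auto
  then obtain s where s: "s \<in> ?I" "\<And>t. t \<in> ?I \<Longrightarrow> norm (d t) \<le> norm (d s)"
    using continuous_attains_sup[of ?I "\<lambda>t. norm (d t)"] \<epsilon> by auto
  have L: "L \<ge> 0" using X by (simp add: lipschitz_bound_def)
  have "norm (d s - d 0) \<le> (L * norm (d s)) * \<bar>s - 0\<bar>"
  proof (rule vector_derivative_bound[of ?I])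
    fix t assume t: "t \<in> ?I"
    have "norm (X (u t) - X (v t)) \<le> L * norm (d t)"
      using X u[OF t] v[OF t] by (simp add: lipschitz_bound_def d_def)
    also have "\<dots> \<le> L * norm (d s)" using L s(2)[OF t] by (rule mult_left_mono[rotated])
    finally show "norm (X (u t) - X (v t)) \<le> L * norm (d s)" .
  qed (use der s \<epsilon> in auto)
  also have "\<dots> \<le> (L * norm (d s)) * \<epsilon>"
    using s L by (intro mult_left_mono) auto
  finally have "norm (d s) \<le> (L * \<epsilon>) * norm (d s)"
    using assms(6) by (simp add: d_def mult_ac)
  then have "(1 - L * \<epsilon>) * norm (d s) \<le> 0" by (simp add: algebra_simps)
  then have "norm (d s) \<le> 0" using \<epsilon> by (simp add: mult_le_0_iff)
  then show ?thesis using s(2)[OF t] by (simp add: d_def)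
qed

text \<open>Only the derivative in each fixed direction is known to be continuous. Near
  \<open>x0\<close> the finitely many frame directions are bounded simultaneously, which bounds the
  operator norm of the derivative on a convex ball.\<close>

lemma smooth_on_locally_lipschitz:
  fixes X :: "'a::real_inner \<Rightarrow> 'b::real_normed_vector"
  assumes E: "parseval_frame (E :: 'a set)" and X: "smooth_on S X" and S: "open S" "x0 \<in> S"
  obtains r L where "r > 0" "cball x0 r \<subseteq> S" "lipschitz_bound L (cball x0 r) X"
proof -
  let ?D = "\<lambda>x. frechet_derivative X (at x)"
  have "\<forall>\<^sub>F x in nhds x0. norm (?D x b) < norm (?D x0 b) + 1" for b
  proof -
    have "isCont (\<lambda>x. ?D x b) x0"
      using smooth_on_continuous[OF smooth_on_frechet_derivative[OF X]] S continuous_on_eq_continuous_at by blast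
    then have "((\<lambda>x. norm (?D x b)) \<longlongrightarrow> norm (?D x0 b)) (nhds x0)"
      using tendsto_at_iff_tendsto_nhds[of "\<lambda>x. ?D x b" x0] by (intro tendsto_norm) (simp add: isCont_def)
    then show ?thesis by (rule order_tendstoD) simp
  qed
  then have "\<forall>\<^sub>F x in nhds x0. \<forall>b\<in>E. norm (?D x b) < norm (?D x0 b) + 1"
    using parseval_frameD(1)[OF E] by (intro eventually_ball_finite) auto
  moreover have "\<forall>\<^sub>F x in nhds x0. x \<in> S" using S by (simp add: eventually_nhds_in_open)
  ultimately have "\<forall>\<^sub>F x in nhds x0. x \<in> S \<and> (\<forall>b\<in>E. norm (?D x b) < norm (?D x0 b) + 1)"
    by (rule eventually_conj[rotated])
  then obtain d where d: "d > 0" "\<And>x. dist x x0 < d \<Longrightarrow> x \<in> S"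
    "\<And>x b. dist x x0 < d \<Longrightarrow> b \<in> E \<Longrightarrow> norm (?D x b) < norm (?D x0 b) + 1"
    unfolding eventually_nhds_metric by blast
  \<comment> \<open>Arises from \<open>norm (?D z b) < norm (?D x0 b) + 1\<close> by expanding a
    vector in the frame and applying the Cauchy-Schwarz inequality to its coefficients.\<close>
  define L where "L = (\<Sum>b\<in>E. norm b * (norm (?D x0 b) + 1))"
  have L: "L \<ge> 0" unfolding L_def by (intro sum_nonneg) auto
  have in_d: "dist x x0 < d" if "x \<in> cball x0 (d / 2)" for x
    using that d(1) by (simp add: dist_commute)
  have "norm (X x - X y) \<le> L * norm (x - y)" if "x \<in> cball x0 (d / 2)" "y \<in> cball x0 (d / 2)" for x y
  proof (rule differentiable_bound[of "cball x0 (d / 2)" X ?D, OF _ _ _ that])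
    fix z assume "z \<in> cball x0 (d / 2)"
    note z = in_d[OF this]
    show der: "(X has_derivative ?D z) (at z within cball x0 (d / 2))"
      using smooth_on_has_derivative[OF X d(2)[OF z]] has_derivative_at_withinI by blast
    then interpret D: bounded_linear "?D z" by (rule has_derivative_bounded_linear)
    show "onorm (?D z) \<le> L"
    proof (rule onorm_bound[OF L])
      fix v
      have "?D z v = ?D z (\<Sum>b\<in>E. inner v b *\<^sub>R b)"
        by (simp only: parseval_frameD(3)[OF E])
      also have "\<dots> = (\<Sum>b\<in>E. inner v b *\<^sub>R ?D z b)" by (simp add: D.sum D.scaleR)
      also have "norm \<dots> \<le> (\<Sum>b\<in>E. norm (inner v b *\<^sub>R ?D z b))" by (rule norm_sum)
      also have "\<dots> \<le> (\<Sum>b\<in>E. (norm v * norm b) * (norm (?D x0 b) + 1))"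
      proof (rule sum_mono)
        fix b assume "b \<in> E"
        then have "norm (?D z b) \<le> norm (?D x0 b) + 1" using d(3)[OF z] by (simp add: less_imp_le)
        then show "norm (inner v b *\<^sub>R ?D z b) \<le> (norm v * norm b) * (norm (?D x0 b) + 1)"
          using Cauchy_Schwarz_ineq2[of v b] by (simp add: mult_mono)
      qed
      also have "\<dots> = L * norm v" by (simp add: L_def sum_distrib_left mult_ac)
      finally show "norm (?D z v) \<le> L * norm v" .
    qed
  qed simp
  then have "lipschitz_bound L (cball x0 (d / 2)) X" using L by (simp add: lipschitz_bound_def)
  moreover have "cball x0 (d / 2) \<subseteq> S" using in_d d(2) by blast
  ultimately show ?thesis using that[of "d / 2" L] d(1) by simp
qed

text \<open>Bootstrapping: if the curve is of class C^k, so is its derivative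
  \<open>X (\<gamma> t)\<close>, and the curve is of class C^(k+1).\<close>

lemma smooth_on_integral_curve:
  fixes X :: "'a::real_inner \<Rightarrow> 'a"
  assumes E: "parseval_frame (E :: 'a set)" and X: "smooth_on S X" and J: "open J"
    and der: "\<And>t. t \<in> J \<Longrightarrow> \<gamma> t \<in> S \<and> (\<gamma> has_vector_derivative X (\<gamma> t)) (at t)"
  shows "smooth_on J \<gamma>"
  unfolding smooth_on_def
proof
  fix k show "Ck_on k J \<gamma>"
  proof (induction k)
    case 0
    then show ?case
      using der by (auto intro!: continuous_at_imp_continuous_on has_vector_derivative_continuous)
  next
    case (Suc k)
    have "Ck_on k S X" using X by (simp add: smooth_on_def)
    then have "Ck_on k J (\<lambda>t. X (\<gamma> t))"
      using der by (intro Ck_on_compose[OF E J Suc]) auto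
    then have "Ck_on k J (\<lambda>t. v *\<^sub>R X (\<gamma> t))" for v
      by (intro Ck_on_scaleR[OF J Ck_on_const])
    then show ?case
      by (intro Ck_on_SucI[OF J, where f' = "\<lambda>t h. h *\<^sub>R X (\<gamma> t)"]) (use der in \<open>auto simp: has_vector_derivative_def\<close>)
  qed
qed

section \<open>One-parameter subgroups of abstract groups\<close>

text \<open>\<open>\<Gamma> t\<close> is \<open>\<gamma> (t / n)\<close> to the power \<open>n\<close>, which does not depend on \<open>n\<close> as long as
  \<open>t / n\<close> is in the domain.\<close>

lemma (in group) local_one_parameter_extension:
  fixes \<gamma> :: "real \<Rightarrow> 'a"
  assumes \<delta>: "\<delta> > 0" and carr: "\<And>t. \<gamma> t \<in> carrier G"
    and hom: "\<And>s t. \<lbrakk>\<bar>s\<bar> < \<delta>; \<bar>t\<bar> < \<delta>; \<bar>s + t\<bar> < \<delta>\<rbrakk> \<Longrightarrow> \<gamma> (s + t) = \<gamma> s \<otimes> \<gamma> t"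
  obtains \<Gamma> :: "real \<Rightarrow> 'a" where "\<And>s t. \<Gamma> (s + t) = \<Gamma> s \<otimes> \<Gamma> t" "\<And>t. \<bar>t\<bar> < \<delta> \<Longrightarrow> \<Gamma> t = \<gamma> t"
proof -
  have \<gamma>0: "\<gamma> 0 = \<one>"
    using hom[of 0 0] \<delta> carr[of 0] by simp
  have pow: "\<gamma> (real k * u) = \<gamma> u [^] k" if "\<bar>real k * u\<bar> < \<delta>" "\<bar>u\<bar> < \<delta>" for k :: nat and u
    using that(1)
  proof (induction k)
    case 0
    then show ?case by (simp add: \<gamma>0)
  next
    case (Suc k)
    have "\<bar>real k * u\<bar> \<le> \<bar>real (Suc k) * u\<bar>"
      by (simp add: abs_mult mult_right_mono)
    then have k: "\<bar>real k * u\<bar> < \<delta>" using Suc.prems by simp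
    have "real (Suc k) * u = real k * u + u" by (simp add: algebra_simps)
    then have "\<gamma> (real (Suc k) * u) = \<gamma> (real k * u) \<otimes> \<gamma> u"
      using hom[OF k that(2)] Suc.prems by simp
    then show ?case using Suc.IH[OF k] by simp
  qed
  \<comment> \<open>The summand \<open>1\<close> makes \<open>N t\<close> strictly larger than
    \<open>\<bar>t\<bar> / \<delta>\<close>, and positive at \<open>t = 0\<close>.\<close>
  define N where "N t = nat \<lceil>\<bar>t\<bar> / \<delta>\<rceil> + 1" for t
  have N: "N t > 0" "\<bar>t / N t\<bar> < \<delta>" for t
  proof -
    show "N t > 0" by (simp add: N_def)
    have "\<bar>t\<bar> / \<delta> < real (N t)" unfolding N_def using \<delta> by simp linarith
    then show "\<bar>t / N t\<bar> < \<delta>" using \<delta> \<open>N t > 0\<close> by (simp add: field_simps)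
  qed
  define \<Gamma> where "\<Gamma> t = \<gamma> (t / N t) [^] N t" for t
  have \<Gamma>: "\<Gamma> t = \<gamma> (t / real n) [^] n" if n: "n > 0" "\<bar>t / real n\<bar> < \<delta>" for t and n :: nat
  proof -
    have refine: "\<gamma> (t / real p) = \<gamma> (t / (real p * real q)) [^] q"
      if "p > 0" "q > 0" "\<bar>t / real p\<bar> < \<delta>" for p q :: nat
    proof -
      have eq: "real q * (t / (real p * real q)) = t / real p" using that by simp
      have "\<bar>t / (real p * real q)\<bar> = \<bar>t / real p\<bar> / real q" by (simp add: abs_mult)
      also have "\<dots> \<le> \<bar>t / real p\<bar>" using that by (simp add: divide_le_eq mult_le_cancel_left1)
      finally have "\<bar>t / (real p * real q)\<bar> < \<delta>" using that by simp
      then show ?thesis using pow[of q "t / (real p * real q)"] eq that by simp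
    qed
    \<comment> \<open>Both subdivisions are compared with their common refinement into
      \<open>n * N t\<close> steps.\<close>
    have "\<gamma> (t / N t) [^] N t = \<gamma> (t / (real (N t) * real n)) [^] (n * N t)"
      using refine[OF N(1)[of t] n(1) N(2)] carr by (simp add: nat_pow_pow)
    moreover have "\<gamma> (t / real n) [^] n = \<gamma> (t / (real n * real (N t))) [^] (N t * n)"
      using refine[OF n(1) N(1)[of t] n(2)] carr by (simp add: nat_pow_pow)
    ultimately show ?thesis by (simp add: \<Gamma>_def mult.commute)
  qed
  have "\<Gamma> (s + t) = \<Gamma> s \<otimes> \<Gamma> t" for s t
  proof -
    \<comment> \<open>One number of steps that is fine enough for \<open>s\<close>, \<open>t\<close>
      and \<open>s + t\<close> at once.\<close>
    define n where "n = N (\<bar>s\<bar> + \<bar>t\<bar>)"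
    have n: "n > 0" "\<bar>(\<bar>s\<bar> + \<bar>t\<bar>) / real n\<bar> < \<delta>" unfolding n_def by (rule N)+
    have le: "\<bar>x / real n\<bar> < \<delta>" if "\<bar>x\<bar> \<le> \<bar>s\<bar> + \<bar>t\<bar>" for x
    proof -
      have "\<bar>x / real n\<bar> \<le> \<bar>(\<bar>s\<bar> + \<bar>t\<bar>) / real n\<bar>"
        using that n(1) by (simp add: divide_right_mono)
      then show ?thesis using n(2) by linarith
    qed
    have s: "\<bar>s / real n\<bar> < \<delta>" and t: "\<bar>t / real n\<bar> < \<delta>" and st: "\<bar>(s + t) / real n\<bar> < \<delta>"
      by (rule le, linarith)+
    have mult: "\<gamma> ((s + t) / real n) = \<gamma> (s / real n) \<otimes> \<gamma> (t / real n)"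
      using hom[OF s t] st by (simp add: add_divide_distrib)
    \<comment> \<open>Commutativity of addition makes the two factors commute, so the power of their
      product splits.\<close>
    have "\<gamma> ((s + t) / real n) = \<gamma> (t / real n) \<otimes> \<gamma> (s / real n)"
      using hom[OF t s] st by (simp add: add_divide_distrib add.commute)
    then have "(\<gamma> (s / real n) \<otimes> \<gamma> (t / real n)) [^] n = \<gamma> (s / real n) [^] n \<otimes> \<gamma> (t / real n) [^] n"
      using carr mult by (intro pow_mult_distrib) auto
    then show ?thesis using \<Gamma>[OF n(1) s] \<Gamma>[OF n(1) t] \<Gamma>[OF n(1) st] mult by simp
  qed
  moreover have "\<Gamma> t = \<gamma> t" if "\<bar>t\<bar> < \<delta>" for t
    using \<Gamma>[of 1 t] that carr by simp
  ultimately show ?thesis using that by blast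
qed

lemma (in group) one_parameter_pow:
  assumes "\<And>s t. \<Gamma> (s + t) = \<Gamma> s \<otimes> \<Gamma> t" "\<And>t. \<Gamma> t \<in> carrier G"
  shows "\<Gamma> (real n * t) = \<Gamma> t [^] n"
proof (induction n)
  case 0
  show ?case using assms(1)[of 0 0] assms(2)[of 0] by simp
next
  case (Suc n)
  have "real (Suc n) * t = real n * t + t" by (simp add: algebra_simps)
  then show ?case using Suc assms(1) by simp
qed

text \<open>Every \<open>\<Gamma> t\<close> is a power of some \<open>\<Gamma> (t / n)\<close> with
  \<open>t / n\<close> in the interval of agreement.\<close>

lemma (in group) one_parameter_eqI:
  fixes \<Gamma> \<Delta> :: "real \<Rightarrow> 'a"
  assumes "\<And>s t. \<Gamma> (s + t) = \<Gamma> s \<otimes> \<Gamma> t" "\<And>t. \<Gamma> t \<in> carrier G"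
    and "\<And>s t. \<Delta> (s + t) = \<Delta> s \<otimes> \<Delta> t" "\<And>t. \<Delta> t \<in> carrier G"
    and "\<epsilon> > 0" "\<And>t. \<bar>t\<bar> < \<epsilon> \<Longrightarrow> \<Gamma> t = \<Delta> t"
  shows "\<Gamma> = \<Delta>"
proof
  fix t
  obtain n :: nat where n: "\<bar>t\<bar> / \<epsilon> < real n" using reals_Archimedean2 by blast
  then have "real n > 0" using assms(5) by (smt (verit) divide_nonneg_pos)
  then have "\<bar>t / real n\<bar> < \<epsilon>" using n assms(5) by (simp add: field_simps)
  then have "\<Gamma> (t / real n) [^] n = \<Delta> (t / real n) [^] n" using assms(6) by simp
  then show "\<Gamma> t = \<Delta> t"
    using one_parameter_pow[of \<Gamma> n "t / real n"] one_parameter_pow[of \<Delta> n "t / real n"] assms(1-4) \<open>real n > 0\<close> by simp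
qed

section \<open>Smooth maps between manifolds\<close>

text \<open>The topological part of \<open>smooth_manifold\<close>, without compatibility of charts.
  It is enough for composing smooth maps and for the chain rule, and is established directly for
  \<open>flat\<close> and for product atlases.\<close>

definition charted :: "('m::topological_space, 'e::real_normed_vector) chart set \<Rightarrow> bool" where
  "charted A \<longleftrightarrow> \<Union> (fst ` A) = UNIV \<and>
     (\<forall>c\<in>A. open (fst c) \<and> open (chart_image c) \<and>
            homeomorphism (fst c) (chart_image c) (snd c) (chart_inv c))"

lemma smooth_manifold_charted: "smooth_manifold A \<Longrightarrow> charted A"
  by (auto simp: smooth_manifold_def charted_def)

lemma smooth_manifold_parseval_frame:
  fixes A :: "('m::{t2_space,second_countable_topology}, 'e::real_inner) chart set"
  assumes "smooth_manifold A"
  obtains E :: "'e set" where "parseval_frame E"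
  using assms parseval_frame_exists unfolding smooth_manifold_def by metis

lemma charted_chart_at:
  assumes "charted A"
  shows "chart_at A x \<in> A" "x \<in> fst (chart_at A x)"
proof -
  have "\<exists>c. c \<in> A \<and> x \<in> fst c" using assms UNIV_I[of x] unfolding charted_def by (metis UN_E)
  from someI_ex[OF this] show "chart_at A x \<in> A" "x \<in> fst (chart_at A x)"
    by (auto simp: chart_at_def)
qed

lemma chartedD:
  assumes "charted A" "c \<in> A"
  shows "open (fst c)" "open (chart_image c)" "continuous_on (fst c) (snd c)"
    "continuous_on (chart_image c) (chart_inv c)"
    "\<And>x. x \<in> fst c \<Longrightarrow> chart_inv c (snd c x) = x"
    "\<And>x. x \<in> fst c \<Longrightarrow> snd c x \<in> chart_image c"
    "\<And>y. y \<in> chart_image c \<Longrightarrow> snd c (chart_inv c y) = y"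
    "\<And>y. y \<in> chart_image c \<Longrightarrow> chart_inv c y \<in> fst c"
  using assms by (auto simp: charted_def homeomorphism_def chart_image_def)

lemma chart_image_Int_eq:
  assumes "charted A" "c \<in> A"
  shows "snd c ` (fst c \<inter> W) = chart_image c \<inter> chart_inv c -` W"
proof -
  note c = chartedD[OF assms]
  show ?thesis
  proof (intro Set.set_eqI iffI)
    fix y assume "y \<in> snd c ` (fst c \<inter> W)"
    then show "y \<in> chart_image c \<inter> chart_inv c -` W" using c by auto
  next
    fix y assume "y \<in> chart_image c \<inter> chart_inv c -` W"
    then show "y \<in> snd c ` (fst c \<inter> W)"
      using c by (intro image_eqI[of y "snd c" "chart_inv c y"]) auto
  qed
qed

lemma open_chart_image_Int:
  assumes "charted A" "c \<in> A" "open W"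
  shows "open (snd c ` (fst c \<inter> W))"
  unfolding chart_image_Int_eq[OF assms(1,2)]
  using continuous_open_preimage[OF chartedD(4,2)[OF assms(1,2)] assms(3)] .

lemma chart_inv_flat [simp]: "chart_inv (UNIV, \<lambda>v. v) = (\<lambda>v. v)"
  by (auto simp: chart_inv_def inv_into_def)

lemma chart_at_flat: "chart_at flat x = (UNIV, \<lambda>v. v)"
proof -
  have "chart_at flat x \<in> flat" unfolding chart_at_def
    by (rule someI2[of _ "(UNIV, \<lambda>v. v)"]) (auto simp: flat_def)
  then show ?thesis by (simp add: flat_def)
qed

lemma charted_flat: "charted flat"
  by (auto simp: charted_def flat_def chart_image_def homeomorphism_def image_def)

lemma chart_inv_prod:
  assumes "charted A" "charted B" "c \<in> A" "d \<in> B" "u \<in> chart_image c" "v \<in> chart_image d"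
  shows "chart_inv (fst c \<times> fst d, map_prod (snd c) (snd d)) (u, v) = (chart_inv c u, chart_inv d v)"
proof -
  note c = chartedD[OF assms(1,3)] and d = chartedD[OF assms(2,4)]
  have "inj_on (snd c) (fst c)" "inj_on (snd d) (fst d)"
    using c(5) d(5) by (metis inj_on_inverseI)+
  then have "inj_on (map_prod (snd c) (snd d)) (fst c \<times> fst d)" by (rule map_prod_inj_on)
  then show ?thesis unfolding chart_inv_def fst_conv snd_conv
    by (rule inv_into_f_eq) (use c d assms(5,6) in \<open>auto simp: chart_inv_def\<close>)
qed

lemma charted_prod:
  assumes A: "charted A" and B: "charted B"
  shows "charted (prod_atlas A B)"
  unfolding charted_def
proof (intro conjI ballI)
  show "\<Union> (fst ` prod_atlas A B) = UNIV"
  proof (intro equalityI subset_UNIV subsetI)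
    fix x :: "'a \<times> 'c"
    have "(fst (chart_at A (fst x)) \<times> fst (chart_at B (snd x)),
      map_prod (snd (chart_at A (fst x))) (snd (chart_at B (snd x)))) \<in> prod_atlas A B"
      using charted_chart_at(1)[OF A] charted_chart_at(1)[OF B] unfolding prod_atlas_def by blast
    moreover have "x \<in> fst (chart_at A (fst x)) \<times> fst (chart_at B (snd x))"
      using charted_chart_at(2)[OF A] charted_chart_at(2)[OF B] by (simp add: mem_Times_iff)
    ultimately show "x \<in> \<Union> (fst ` prod_atlas A B)" by force
  qed
next
  fix e assume "e \<in> prod_atlas A B"
  then obtain c d where e: "e = (fst c \<times> fst d, map_prod (snd c) (snd d))" "c \<in> A" "d \<in> B"
    by (auto simp: prod_atlas_def)
  note c = chartedD[OF A e(2)] and d = chartedD[OF B e(3)]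
  have fe: "fst e = fst c \<times> fst d" and se: "snd e x = (snd c (fst x), snd d (snd x))" for x
    by (auto simp: e(1) map_prod_def split_beta)
  show "open (fst e)" using c d by (simp add: fe open_Times)
  have im: "chart_image e = chart_image c \<times> chart_image d"
    by (force simp: e(1) chart_image_def)
  then show "open (chart_image e)" using c d by (simp add: open_Times)
  have inv: "chart_inv e y = (chart_inv c (fst y), chart_inv d (snd y))" if "y \<in> chart_image e" for y
    using chart_inv_prod[OF A B e(2,3), of "fst y" "snd y"] that unfolding im e(1)[symmetric] by auto
  show "homeomorphism (fst e) (chart_image e) (snd e) (chart_inv e)"
  proof (rule homeomorphismI)
    show "continuous_on (fst e) (snd e)"
    proof (rule continuous_on_eq)
      show "continuous_on (fst e) (\<lambda>x. (snd c (fst x), snd d (snd x)))"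
        by (intro continuous_on_Pair continuous_on_compose2[OF c(3)] continuous_on_compose2[OF d(3)] continuous_intros)
          (auto simp: fe)
    qed (simp add: se)
    show "continuous_on (chart_image e) (chart_inv e)"
    proof (rule continuous_on_eq)
      show "continuous_on (chart_image e) (\<lambda>y. (chart_inv c (fst y), chart_inv d (snd y)))"
        by (intro continuous_on_Pair continuous_on_compose2[OF c(4)] continuous_on_compose2[OF d(4)] continuous_intros)
          (auto simp: im)
    qed (simp add: inv)
    show "snd e ` fst e \<subseteq> chart_image e" by (simp add: chart_image_def)
    show "chart_inv e ` chart_image e \<subseteq> fst e"
      using c(8) d(8) by (auto simp: inv fe) (auto simp: im)
    show "chart_inv e (snd e x) = x" if "x \<in> fst e" for x
    proof -
      have "snd e x \<in> chart_image e" using that by (simp add: chart_image_def)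
      then show ?thesis using that c(5) d(5) by (auto simp: inv se fe)
    qed
    show "snd e (chart_inv e y) = y" if "y \<in> chart_image e" for y
      using that c(7) d(7) by (simp add: inv se) (auto simp: im)
  qed
qed

section \<open>Composition and pairing of smooth maps\<close>

lemma smooth_map_smooth_on:
  assumes "smooth_map A B F" "c \<in> A" "d \<in> B"
  shows "smooth_on (snd c ` (fst c \<inter> F -` fst d)) (\<lambda>y. snd d (F (chart_inv c y)))"
  using assms by (auto simp: smooth_map_def o_def)

lemma smooth_map_continuous: "smooth_map A B F \<Longrightarrow> continuous_on UNIV F"
  by (simp add: smooth_map_def)

lemma smooth_map_open_vimage: "smooth_map A B F \<Longrightarrow> open W \<Longrightarrow> open (F -` W)"
  using smooth_map_continuous open_vimage by blast

lemma smooth_map_id: "smooth_manifold A \<Longrightarrow> smooth_map A A (\<lambda>x. x)"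
  by (auto simp: smooth_map_def smooth_manifold_def o_def vimage_def)

lemma smooth_map_const: "smooth_map A B (\<lambda>_. y)"
  by (auto simp: smooth_map_def o_def smooth_on_const)

lemma smooth_map_flatI:
  assumes "continuous_on UNIV f" "\<And>c. c \<in> A \<Longrightarrow> smooth_on (chart_image c) (\<lambda>y. f (chart_inv c y))"
  shows "smooth_map A flat f"
  using assms by (auto simp: smooth_map_def flat_def o_def chart_image_def)

lemma smooth_map_flatD:
  "smooth_map A flat f \<Longrightarrow> c \<in> A \<Longrightarrow> smooth_on (chart_image c) (\<lambda>y. f (chart_inv c y))"
  by (auto simp: smooth_map_def flat_def o_def chart_image_def)

text \<open>For given outer charts the intermediate point need not stay in one chart of
  \<open>B\<close>, so smoothness is proved locally, with a chart of \<open>B\<close> chosen around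
  each \<open>F x\<close>.\<close>

lemma smooth_map_compose:
  fixes B :: "('n::topological_space, 'f::real_inner) chart set"
  assumes A: "charted A" and B: "charted B" and C: "charted C" and E: "parseval_frame (E :: 'f set)"
    and F: "smooth_map A B F" and G: "smooth_map B C G"
  shows "smooth_map A C (\<lambda>x. G (F x))"
  unfolding smooth_map_def
proof (intro conjI ballI)
  show "continuous_on UNIV (\<lambda>x. G (F x))"
    using smooth_map_continuous[OF F] smooth_map_continuous[OF G]
    by (auto intro: continuous_on_compose2)
next
  fix c d assume cd: "c \<in> A" "d \<in> C"
  note c = chartedD[OF A cd(1)] and d = chartedD[OF C cd(2)]
  have "smooth_on (snd c ` (fst c \<inter> (\<lambda>x. G (F x)) -` fst d)) (\<lambda>y. snd d (G (F (chart_inv c y))))"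
  proof (rule smooth_on_local)
    fix y assume "y \<in> snd c ` (fst c \<inter> (\<lambda>x. G (F x)) -` fst d)"
    then obtain x where x: "x \<in> fst c" "G (F x) \<in> fst d" "y = snd c x" by auto
    define b where "b = chart_at B (F x)"
    have b: "b \<in> B" "F x \<in> fst b" using charted_chart_at[OF B] by (auto simp: b_def)
    note b' = chartedD[OF B b(1)]
    define V where "V = fst b \<inter> G -` fst d"
    have V: "open V" using b' smooth_map_open_vimage[OF G d(1)] by (auto simp: V_def)
    define U where "U = snd c ` (fst c \<inter> F -` V)"
    have U: "open U"
      unfolding U_def by (intro open_chart_image_Int[OF A cd(1)] smooth_map_open_vimage[OF F V])
    have "smooth_on U (\<lambda>y. (\<lambda>z. snd d (G (chart_inv b z))) (snd b (F (chart_inv c y))))"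
    proof (rule smooth_on_compose[OF E U _ smooth_map_smooth_on[OF G b(1) cd(2)]])
      show "smooth_on U (\<lambda>y. snd b (F (chart_inv c y)))"
        by (rule smooth_on_subset[OF smooth_map_smooth_on[OF F cd(1) b(1)]]) (auto simp: U_def V_def)
      show "(\<lambda>y. snd b (F (chart_inv c y))) ` U \<subseteq> snd b ` (fst b \<inter> G -` fst d)"
        using c by (auto simp: U_def V_def)
    qed
    then have "smooth_on U (\<lambda>y. snd d (G (F (chart_inv c y))))"
      by (rule smooth_on_cong[OF _ U]) (use c b' in \<open>auto simp: U_def V_def\<close>)
    then show "\<exists>U. open U \<and> y \<in> U \<and> smooth_on U (\<lambda>y. snd d (G (F (chart_inv c y))))"
      using U x b by (auto simp: U_def V_def)
  qed
  then show "smooth_on (snd c ` (fst c \<inter> (\<lambda>x. G (F x)) -` fst d)) (snd d \<circ> (\<lambda>x. G (F x)) \<circ> chart_inv c)"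
    by (simp add: o_def)
qed

lemma smooth_map_Pair:
  assumes A: "charted A" and B: "charted B" and C: "charted C"
    and F: "smooth_map A B F" and G: "smooth_map A C G"
  shows "smooth_map A (prod_atlas B C) (\<lambda>x. (F x, G x))"
  unfolding smooth_map_def
proof (intro conjI ballI)
  show "continuous_on UNIV (\<lambda>x. (F x, G x))"
    using smooth_map_continuous[OF F] smooth_map_continuous[OF G] by (rule continuous_on_Pair)
next
  fix c e assume c: "c \<in> A" and "e \<in> prod_atlas B C"
  then obtain b d where e: "e = (fst b \<times> fst d, map_prod (snd b) (snd d))" "b \<in> B" "d \<in> C"
    by (auto simp: prod_atlas_def)
  let ?U = "snd c ` (fst c \<inter> (\<lambda>x. (F x, G x)) -` fst e)"
  have "open (fst e)" using chartedD(1)[OF B e(2)] chartedD(1)[OF C e(3)] by (simp add: e open_Times)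
  then have "open ((\<lambda>x. (F x, G x)) -` fst e)"
    using continuous_on_Pair[OF smooth_map_continuous[OF F] smooth_map_continuous[OF G]] open_vimage by blast
  then have U: "open ?U" by (rule open_chart_image_Int[OF A c])
  have "smooth_on ?U (\<lambda>y. (snd b (F (chart_inv c y)), snd d (G (chart_inv c y))))"
    by (intro smooth_on_Pair[OF U] smooth_on_subset[OF smooth_map_smooth_on[OF F c e(2)]]
        smooth_on_subset[OF smooth_map_smooth_on[OF G c e(3)]]) (auto simp: e)
  then show "smooth_on ?U (snd e \<circ> (\<lambda>x. (F x, G x)) \<circ> chart_inv c)"
    by (simp add: o_def e)
qed

text \<open>The derivative in arbitrary charts. \<open>tangent_map\<close> is the case of preferred
  charts and \<open>transition_deriv\<close> the case of the identity map, so a single chain rule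
  serves for both.\<close>

definition chart_deriv :: "('m, 'e::real_normed_vector) chart \<Rightarrow> ('n, 'f::real_normed_vector) chart \<Rightarrow>
   ('m \<Rightarrow> 'n) \<Rightarrow> 'm \<Rightarrow> 'e \<Rightarrow> 'f" where
  "chart_deriv c d F x = frechet_derivative (\<lambda>y. snd d (F (chart_inv c y))) (at (snd c x))"

lemma tangent_map_eq_chart_deriv: "tangent_map A B F x = chart_deriv (chart_at A x) (chart_at B (F x)) F x"
  by (simp add: tangent_map_def chart_deriv_def o_def)

lemma transition_deriv_eq_chart_deriv: "transition_deriv c d x = chart_deriv c d (\<lambda>x. x) x"
  by (simp add: transition_deriv_def chart_deriv_def o_def)

lemma smooth_map_has_derivative:
  assumes "smooth_map A B F" "c \<in> A" "d \<in> B" "x \<in> fst c" "F x \<in> fst d"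
  shows "((\<lambda>y. snd d (F (chart_inv c y))) has_derivative chart_deriv c d F x) (at (snd c x))"
  unfolding chart_deriv_def
  by (rule smooth_on_has_derivative[OF smooth_map_smooth_on[OF assms(1-3)]]) (use assms in auto)

lemma chart_deriv_bounded_linear:
  "\<lbrakk>smooth_map A B F; c \<in> A; d \<in> B; x \<in> fst c; F x \<in> fst d\<rbrakk> \<Longrightarrow> bounded_linear (chart_deriv c d F x)"
  using smooth_map_has_derivative has_derivative_bounded_linear by blast

lemma chart_deriv_compose:
  assumes A: "charted A" and B: "charted B" and C: "charted C"
    and F: "smooth_map A B F" and G: "smooth_map B C G"
    and ch: "c \<in> A" "b \<in> B" "d \<in> C" and x: "x \<in> fst c" "F x \<in> fst b" "G (F x) \<in> fst d"
  shows "chart_deriv c d (\<lambda>x. G (F x)) x v = chart_deriv b d G (F x) (chart_deriv c b F x v)"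
proof -
  note c = chartedD[OF A ch(1)] and b = chartedD[OF B ch(2)] and d = chartedD[OF C ch(3)]
  define U where "U = snd c ` (fst c \<inter> F -` fst b)"
  have U: "open U"
    unfolding U_def by (intro open_chart_image_Int[OF A ch(1)] smooth_map_open_vimage[OF F b(1)])
  have "snd c x \<in> U" using x by (auto simp: U_def)
  have "snd b (F (chart_inv c (snd c x))) = snd b (F x)" using c x by simp
  then have "((\<lambda>z. snd d (G (chart_inv b z))) has_derivative chart_deriv b d G (F x))
      (at (snd b (F (chart_inv c (snd c x)))))"
    using smooth_map_has_derivative[OF G ch(2,3) x(2,3)] by simp
  from has_derivative_compose[OF smooth_map_has_derivative[OF F ch(1,2) x(1,2)] this]
  have "((\<lambda>y. snd d (G (F (chart_inv c y)))) has_derivative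
      (\<lambda>v. chart_deriv b d G (F x) (chart_deriv c b F x v))) (at (snd c x))"
    by (rule has_derivative_transform_within_open[OF _ U \<open>snd c x \<in> U\<close>])
      (use b c in \<open>auto simp: U_def\<close>)
  then show ?thesis by (simp add: chart_deriv_def frechet_derivative_eqI)
qed

lemma tangent_map_compose:
  assumes A: "charted A" and B: "charted B" and C: "charted C"
    and F: "smooth_map A B F" and G: "smooth_map B C G"
  shows "tangent_map A C (\<lambda>x. G (F x)) x v = tangent_map B C G (F x) (tangent_map A B F x v)"
  unfolding tangent_map_eq_chart_deriv
  by (rule chart_deriv_compose[OF assms]) (auto simp: charted_chart_at A B C)

text \<open>Changing the target chart is composition with the identity, which is smooth because the
  charts of \<open>B\<close> are compatible.\<close>

lemma to_chart_tangent_map: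
  assumes A: "charted A" and B: "smooth_manifold B"
    and F: "smooth_map A B F" and d: "d \<in> B" "F x \<in> fst d"
  shows "to_chart B d (F x) (tangent_map A B F x v) = chart_deriv (chart_at A x) d F x v"
  unfolding to_chart_def transition_deriv_eq_chart_deriv tangent_map_eq_chart_deriv
  using smooth_manifold_charted[OF B]
  by (intro chart_deriv_compose[OF A _ _ F smooth_map_id[OF B], symmetric])
    (auto simp: charted_chart_at A d)

lemma chart_deriv_const: "chart_deriv c d (\<lambda>_. y) x v = 0"
  by (simp add: chart_deriv_def)

lemma chart_deriv_id:
  assumes "charted A" "c \<in> A" "x \<in> fst c"
  shows "chart_deriv c c (\<lambda>x. x) x v = v"
proof -
  note c = chartedD[OF assms(1,2)]
  have "frechet_derivative (\<lambda>y. snd c (chart_inv c y)) (at (snd c x)) = frechet_derivative (\<lambda>y. y) (at (snd c x))"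
    by (rule frechet_derivative_cong_open[OF c(2)]) (use c assms(3) in auto)
  then show ?thesis by (simp add: chart_deriv_def)
qed

section \<open>Lie groups in a chart at the identity\<close>

locale lie_group_charts =
  fixes G :: "('g::{t2_space,second_countable_topology}) monoid"
    and B :: "('g, 'f::{real_inner,complete_space}) chart set"
  assumes lie: "lie_group G B"
begin

sublocale group G
  using lie by (simp add: lie_group_def)

lemma in_carrier [simp]: "a \<in> carrier G"
  using lie by (simp add: lie_group_def)

lemma B: "smooth_manifold B" "charted B"
  using lie smooth_manifold_charted by (auto simp: lie_group_def)

definition frame :: "'f set" where "frame = (SOME E. parseval_frame E)"

lemma frame: "parseval_frame frame"
proof -
  obtain E :: "'f set" where "parseval_frame E" using smooth_manifold_parseval_frame[OF B(1)] .
  then show ?thesis unfolding frame_def by (rule someI)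
qed

lemmas frame_prod = parseval_frame_prod[OF frame frame]

text \<open>This is the preferred chart at the identity, so a vector of the Lie algebra is its own
  component vector in it and no chart change occurs there.\<close>

definition c0 where "c0 = chart_at B \<one>\<^bsub>G\<^esub>"
abbreviation "U \<equiv> fst c0"
abbreviation "\<phi> \<equiv> snd c0"
abbreviation "\<psi> \<equiv> chart_inv c0"
abbreviation "W \<equiv> chart_image c0"
definition e where "e = \<phi> \<one>\<^bsub>G\<^esub>"
definition m where "m p = \<phi> (\<psi> (fst p) \<otimes>\<^bsub>G\<^esub> \<psi> (snd p))"
definition D where "D = {p. fst p \<in> W \<and> snd p \<in> W \<and> \<psi> (fst p) \<otimes>\<^bsub>G\<^esub> \<psi> (snd p) \<in> U}"

lemma c0: "c0 \<in> B" "\<one>\<^bsub>G\<^esub> \<in> U"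
  using charted_chart_at[OF B(2)] by (auto simp: c0_def)

lemmas c0D = chartedD[OF B(2) c0(1)]

lemma e_in_W: "e \<in> W" and \<psi>_e [simp]: "\<psi> e = \<one>\<^bsub>G\<^esub>"
  using c0D c0 by (auto simp: e_def)

lemma smooth_mult: "smooth_map (prod_atlas B B) B (\<lambda>p. fst p \<otimes>\<^bsub>G\<^esub> snd p)"
  using lie by (simp add: lie_group_def case_prod_unfold)

lemma open_D: "open D" and smooth_m: "smooth_on D m"
proof -
  let ?c = "(U \<times> U, map_prod \<phi> \<phi>)"
  have c: "?c \<in> prod_atlas B B" using c0(1) unfolding prod_atlas_def by blast
  have im: "chart_image ?c = W \<times> W" by (force simp: chart_image_def)
  have inv: "chart_inv ?c p = (\<psi> (fst p), \<psi> (snd p))" if "p \<in> W \<times> W" for p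
    using chart_inv_prod[OF B(2) B(2) c0(1) c0(1), of "fst p" "snd p"] that by auto
  have D: "D = snd ?c ` (fst ?c \<inter> (\<lambda>p. fst p \<otimes>\<^bsub>G\<^esub> snd p) -` U)"
    unfolding chart_image_Int_eq[OF charted_prod[OF B(2) B(2)] c] im
    by (auto simp: D_def inv)
  show "open D"
    unfolding D by (intro open_chart_image_Int[OF charted_prod[OF B(2) B(2)] c] smooth_map_open_vimage[OF smooth_mult] c0D)
  show "smooth_on D m"
    by (rule smooth_on_cong[OF smooth_map_smooth_on[OF smooth_mult c c0(1), folded D] \<open>open D\<close>])
      (auto simp: m_def inv D_def mem_Times_iff)
qed

lemma m_e_right: "u \<in> W \<Longrightarrow> (u, e) \<in> D \<and> m (u, e) = u"
  and m_e_left: "u \<in> W \<Longrightarrow> (e, u) \<in> D \<and> m (e, u) = u"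
  using c0D e_in_W by (auto simp: D_def m_def)

lemma m_has_derivative: "p \<in> D \<Longrightarrow> (m has_derivative frechet_derivative m (at p)) (at p)"
  by (rule smooth_on_has_derivative[OF smooth_m])

section \<open>Products of group-valued maps and left-invariant fields\<close>

lemma smooth_map_mult:
  assumes A: "charted A" and F: "smooth_map A B F" and H: "smooth_map A B H"
  shows "smooth_map A B (\<lambda>x. F x \<otimes>\<^bsub>G\<^esub> H x)"
  using smooth_map_compose[OF A charted_prod[OF B(2) B(2)] B(2) frame_prod smooth_map_Pair[OF A B(2) B(2) F H] smooth_mult]
  by simp

lemma smooth_map_left_mult: "smooth_map B B (\<lambda>b. a \<otimes>\<^bsub>G\<^esub> b)"
  by (rule smooth_map_mult[OF B(2) smooth_map_const smooth_map_id[OF B(1)]])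

text \<open>Leibniz rule for products of group-valued maps. Left translations and conjugations are
  products with constant maps, and their derivatives are read off from it.\<close>

lemma chart_deriv_mult:
  assumes A: "charted A" and F: "smooth_map A B F" and H: "smooth_map A B H"
    and c: "c \<in> A" "x \<in> fst c" and x: "F x \<in> U" "H x \<in> U" "F x \<otimes>\<^bsub>G\<^esub> H x \<in> U"
  shows "chart_deriv c c0 (\<lambda>x. F x \<otimes>\<^bsub>G\<^esub> H x) x v =
    frechet_derivative m (at (\<phi> (F x), \<phi> (H x))) (chart_deriv c c0 F x v, chart_deriv c c0 H x v)"
proof -
  note cD = chartedD[OF A c(1)]
  define V where "V = snd c ` (fst c \<inter> (F -` U \<inter> H -` U))"
  have V: "open V" "snd c x \<in> V"
    unfolding V_def using c x
    by (auto intro!: open_chart_image_Int[OF A c(1)] open_Int smooth_map_open_vimage[OF F] smooth_map_open_vimage[OF H] c0D(1))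
  have "((\<lambda>y. (\<phi> (F (chart_inv c y)), \<phi> (H (chart_inv c y)))) has_derivative
      (\<lambda>v. (chart_deriv c c0 F x v, chart_deriv c c0 H x v))) (at (snd c x))"
    by (intro has_derivative_Pair smooth_map_has_derivative[OF F] smooth_map_has_derivative[OF H] c c0 x)
  moreover have "(m has_derivative frechet_derivative m (at (\<phi> (F x), \<phi> (H x))))
      (at (\<phi> (F (chart_inv c (snd c x))), \<phi> (H (chart_inv c (snd c x)))))"
    using m_has_derivative[of "(\<phi> (F x), \<phi> (H x))"] x c cD c0D by (simp add: D_def)
  ultimately have "((\<lambda>y. m (\<phi> (F (chart_inv c y)), \<phi> (H (chart_inv c y)))) has_derivative
      (\<lambda>v. frechet_derivative m (at (\<phi> (F x), \<phi> (H x))) (chart_deriv c c0 F x v, chart_deriv c c0 H x v))) (at (snd c x))"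
    by (rule has_derivative_compose)
  then have "((\<lambda>y. \<phi> (F (chart_inv c y) \<otimes>\<^bsub>G\<^esub> H (chart_inv c y))) has_derivative
      (\<lambda>v. frechet_derivative m (at (\<phi> (F x), \<phi> (H x))) (chart_deriv c c0 F x v, chart_deriv c c0 H x v))) (at (snd c x))"
    by (rule has_derivative_transform_within_open[OF _ V]) (use cD c0D in \<open>auto simp: V_def m_def\<close>)
  then show ?thesis by (simp add: chart_deriv_def[of _ _ "\<lambda>x. F x \<otimes>\<^bsub>G\<^esub> H x"] frechet_derivative_eqI)
qed

text \<open>The left-invariant field with value \<open>\<xi>\<close> at the identity, in the chart:
  left translation by \<open>u\<close> is differentiated at \<open>e\<close>.\<close>

definition X where "X \<xi> u = frechet_derivative m (at (u, e)) (0, \<xi>)"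

lemma smooth_X: "smooth_on W (X \<xi>)"
proof -
  have "smooth_on W (\<lambda>u. (u, e))"
    by (intro smooth_on_Pair smooth_on_id smooth_on_const c0D)
  then show ?thesis unfolding X_def
    by (intro smooth_on_compose[OF frame_prod c0D(2) _ smooth_on_frechet_derivative[OF smooth_m]])
      (use m_e_right in auto)
qed

lemma chart_deriv_left_mult:
  assumes "a \<in> U"
  shows "chart_deriv c0 c0 (\<lambda>b. a \<otimes>\<^bsub>G\<^esub> b) \<one>\<^bsub>G\<^esub> \<xi> = X \<xi> (\<phi> a)"
  using chart_deriv_mult[OF B(2) smooth_map_const smooth_map_id[OF B(1)] c0 assms c0(2), of \<xi>] assms
  by (simp add: chart_deriv_const chart_deriv_id[OF B(2) c0] X_def e_def)

text \<open>Differentiate the associative law \<open>(u v) b = u (v b)\<close> with respect to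
  \<open>b\<close> at the identity.\<close>

lemma left_invariance:
  assumes "(u, v) \<in> D"
  shows "frechet_derivative m (at (u, v)) (0, X \<xi> v) = X \<xi> (m (u, v))"
proof -
  have uv: "u \<in> W" "v \<in> W" "\<psi> u \<otimes>\<^bsub>G\<^esub> \<psi> v \<in> U" using assms by (auto simp: D_def)
  have "X \<xi> (m (u, v)) = chart_deriv c0 c0 (\<lambda>b. (\<psi> u \<otimes>\<^bsub>G\<^esub> \<psi> v) \<otimes>\<^bsub>G\<^esub> b) \<one>\<^bsub>G\<^esub> \<xi>"
    using chart_deriv_left_mult[OF uv(3)] by (simp add: m_def)
  also have "\<dots> = chart_deriv c0 c0 (\<lambda>b. \<psi> u \<otimes>\<^bsub>G\<^esub> (\<psi> v \<otimes>\<^bsub>G\<^esub> b)) \<one>\<^bsub>G\<^esub> \<xi>"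
    by (simp add: m_assoc)
  also have "\<dots> = frechet_derivative m (at (u, v)) (0, X \<xi> v)"
    using chart_deriv_mult[OF B(2) smooth_map_const smooth_map_left_mult c0, of "\<psi> u" "\<psi> v" \<xi>] uv c0D
    by (simp add: chart_deriv_const chart_deriv_left_mult)
  finally show ?thesis by simp
qed

text \<open>Derivatives of the unit laws. The second one is needed at all points
  \<open>(u, e)\<close>: it says that the partial derivative in the first slot does not vary along
  this slice.\<close>

lemma deriv_m_right: "frechet_derivative m (at (e, e)) (0, v) = v"
  and deriv_m_left: "u \<in> W \<Longrightarrow> frechet_derivative m (at (u, e)) (v, 0) = v"
proof -
  have "((\<lambda>v. (e, v)) has_derivative (\<lambda>v. (0, v))) (at e)"
    by (auto intro!: derivative_eq_intros)
  from has_derivative_compose[OF this m_has_derivative] 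
  have "((\<lambda>v. m (e, v)) has_derivative (\<lambda>v. frechet_derivative m (at (e, e)) (0, v))) (at e)"
    using m_e_left[OF e_in_W] by simp
  then have "((\<lambda>v. v) has_derivative (\<lambda>v. frechet_derivative m (at (e, e)) (0, v))) (at e)"
    by (rule has_derivative_transform_within_open[OF _ c0D(2) e_in_W]) (simp add: m_e_left)
  from fun_cong[OF has_derivative_unique[OF this has_derivative_ident]]
  show "frechet_derivative m (at (e, e)) (0, v) = v" .
next
  assume u: "u \<in> W"
  have "((\<lambda>v. (v, e)) has_derivative (\<lambda>v. (v, 0))) (at u)"
    by (auto intro!: derivative_eq_intros)
  from has_derivative_compose[OF this m_has_derivative] 
  have "((\<lambda>v. m (v, e)) has_derivative (\<lambda>v. frechet_derivative m (at (u, e)) (v, 0))) (at u)"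
    using m_e_right[OF u] by simp
  then have "((\<lambda>v. v) has_derivative (\<lambda>v. frechet_derivative m (at (u, e)) (v, 0))) (at u)"
    by (rule has_derivative_transform_within_open[OF _ c0D(2) u]) (simp add: m_e_right)
  from fun_cong[OF has_derivative_unique[OF this has_derivative_ident]]
  show "frechet_derivative m (at (u, e)) (v, 0) = v" .
qed

lemma X_e: "X \<xi> e = \<xi>"
  by (simp add: X_def deriv_m_right)

text \<open>The value of the field at a point is given in the arbitrary preferred chart there;
  passing to \<open>c0\<close> removes this dependence and leaves the smooth expression
  \<open>X\<close>.\<close>

lemma vf_in_chart_left_invariant_vf:
  assumes "y \<in> W"
  shows "vf_in_chart B (left_invariant_vf G B \<xi>) c0 y = X \<xi> y"
  using to_chart_tangent_map[OF B(2) B(1) smooth_map_left_mult c0(1), of "\<psi> y" "\<one>\<^bsub>G\<^esub>" \<xi>]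
    c0D assms chart_deriv_left_mult[of "\<psi> y" \<xi>]
  by (simp add: vf_in_chart_def left_invariant_vf_def c0_def[symmetric])

lemma left_invariant_vf_one: "left_invariant_vf G B \<xi> \<one>\<^bsub>G\<^esub> = \<xi>"
  using chart_deriv_left_mult[OF c0(2), of \<xi>] X_e
  by (simp add: left_invariant_vf_def tangent_map_eq_chart_deriv c0_def[symmetric] e_def)

lemma lie_algebra_bracket_eq:
  "lie_algebra_bracket G B \<xi> \<eta> = frechet_derivative (X \<eta>) (at e) \<xi> - frechet_derivative (X \<xi>) (at e) \<eta>"
proof -
  have "frechet_derivative (vf_in_chart B (left_invariant_vf G B \<xi>) c0) (at e) = frechet_derivative (X \<xi>) (at e)" for \<xi>
    by (rule frechet_derivative_cong_open[OF c0D(2) e_in_W]) (rule vf_in_chart_left_invariant_vf)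
  then show ?thesis
    by (simp add: lie_algebra_bracket_def vf_bracket_def c0_def[symmetric] e_def[symmetric] left_invariant_vf_one)
qed

section \<open>Uniqueness and existence of one-parameter subgroups\<close>

lemma has_vector_derivative_velocity:
  assumes \<gamma>: "smooth_map flat B \<gamma>" "\<gamma> 0 = \<one>\<^bsub>G\<^esub>"
  shows "((\<lambda>t. \<phi> (\<gamma> t)) has_vector_derivative velocity B \<gamma> 0) (at 0)"
proof -
  let ?id = "(UNIV, \<lambda>v. v) :: (real, real) chart"
  have *: "((\<lambda>t. \<phi> (\<gamma> t)) has_derivative chart_deriv ?id c0 \<gamma> 0) (at 0)"
    using smooth_map_has_derivative[OF \<gamma>(1) _ c0(1), of ?id 0] \<gamma> c0 by (simp add: flat_def)
  interpret L: bounded_linear "chart_deriv ?id c0 \<gamma> 0" using * by (rule has_derivative_bounded_linear)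
  have "chart_deriv ?id c0 \<gamma> 0 h = h *\<^sub>R velocity B \<gamma> 0" for h
    using L.scaleR[of h 1] \<gamma>(2)
    by (simp add: velocity_def tangent_map_eq_chart_deriv chart_at_flat c0_def[symmetric])
  then have "chart_deriv ?id c0 \<gamma> 0 = (\<lambda>h. h *\<^sub>R velocity B \<gamma> 0)" by (rule ext)
  then show ?thesis using * by (simp add: has_vector_derivative_def)
qed

lemma velocity_eqI:
  assumes "((\<lambda>t. \<phi> (\<gamma> t)) has_vector_derivative \<xi>) (at 0)" "\<gamma> 0 = \<one>\<^bsub>G\<^esub>"
  shows "velocity B \<gamma> 0 = \<xi>"
  using assms(1) frechet_derivative_eqI[of "\<lambda>t. \<phi> (\<gamma> t)" "\<lambda>h. h *\<^sub>R \<xi>" 0]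
  by (simp add: velocity_def tangent_map_eq_chart_deriv chart_at_flat assms(2) c0_def[symmetric]
      chart_deriv_def has_vector_derivative_def)

lemma one_parameter_subgroup_0:
  assumes "one_parameter_subgroup G B \<gamma>"
  shows "\<gamma> 0 = \<one>\<^bsub>G\<^esub>"
proof -
  have "\<gamma> (0 + 0) = \<gamma> 0 \<otimes>\<^bsub>G\<^esub> \<gamma> 0" using assms by (simp only: one_parameter_subgroup_def)
  then show ?thesis by simp
qed

lemma one_parameter_subgroup_minus:
  assumes "one_parameter_subgroup G B \<gamma>"
  shows "\<gamma> (- t) = inv\<^bsub>G\<^esub> \<gamma> t"
proof -
  have "\<gamma> (- t + t) = \<gamma> (- t) \<otimes>\<^bsub>G\<^esub> \<gamma> t" using assms by (simp only: one_parameter_subgroup_def)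
  then show ?thesis using one_parameter_subgroup_0[OF assms] inv_equality[of "\<gamma> (- t)" "\<gamma> t"] by simp
qed

text \<open>Differentiate \<open>\<gamma> (t + h) = \<gamma> t \<gamma> h\<close> with respect to
  \<open>h\<close> at \<open>0\<close>.\<close>

lemma one_parameter_subgroup_ode:
  assumes \<gamma>: "one_parameter_subgroup G B \<gamma>" and t: "\<gamma> t \<in> U"
  shows "((\<lambda>t. \<phi> (\<gamma> t)) has_vector_derivative X (velocity B \<gamma> 0) (\<phi> (\<gamma> t))) (at t)"
proof -
  have sm: "smooth_map flat B \<gamma>" and hom: "\<And>s t. \<gamma> (s + t) = \<gamma> s \<otimes>\<^bsub>G\<^esub> \<gamma> t"
    using \<gamma> by (auto simp: one_parameter_subgroup_def)
  note \<gamma>0 = one_parameter_subgroup_0[OF \<gamma>]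
  note v = has_vector_derivative_velocity[OF sm \<gamma>0]
  let ?N = "{p. \<gamma> p \<in> U}"
  have "open ?N" using smooth_map_open_vimage[OF sm c0D(1)] by (simp add: vimage_def)
  have "((\<lambda>h. (\<phi> (\<gamma> t), \<phi> (\<gamma> h))) has_derivative (\<lambda>h. (0, h *\<^sub>R velocity B \<gamma> 0))) (at 0)"
    using v unfolding has_vector_derivative_def by (intro has_derivative_Pair has_derivative_const)
  from has_derivative_compose[OF this, of m "frechet_derivative m (at (\<phi> (\<gamma> t), e))"]
  have "((\<lambda>h. m (\<phi> (\<gamma> t), \<phi> (\<gamma> h))) has_derivative
     (\<lambda>h. frechet_derivative m (at (\<phi> (\<gamma> t), e)) (0, h *\<^sub>R velocity B \<gamma> 0))) (at 0)"
    using m_has_derivative m_e_right[of "\<phi> (\<gamma> t)"] t c0D by (simp add: \<gamma>0 e_def[symmetric])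
  moreover have "frechet_derivative m (at (\<phi> (\<gamma> t), e)) (0, h *\<^sub>R velocity B \<gamma> 0)
    = h *\<^sub>R X (velocity B \<gamma> 0) (\<phi> (\<gamma> t))" for h
  proof -
    interpret L: bounded_linear "frechet_derivative m (at (\<phi> (\<gamma> t), e))"
      using m_has_derivative m_e_right[of "\<phi> (\<gamma> t)"] t c0D has_derivative_bounded_linear by blast
    show ?thesis using L.scaleR[of h "(0, velocity B \<gamma> 0)"] by (simp add: X_def)
  qed
  ultimately have "((\<lambda>h. m (\<phi> (\<gamma> t), \<phi> (\<gamma> h))) has_derivative
     (\<lambda>h. h *\<^sub>R X (velocity B \<gamma> 0) (\<phi> (\<gamma> t)))) (at 0)" by simp
  then have "((\<lambda>h. \<phi> (\<gamma> (t + h))) has_derivative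
     (\<lambda>h. h *\<^sub>R X (velocity B \<gamma> 0) (\<phi> (\<gamma> t)))) (at 0)"
    by (rule has_derivative_transform_within_open[OF _ \<open>open ?N\<close>])
      (use \<gamma>0 c0 c0D t in \<open>auto simp: m_def hom\<close>)
  \<comment> \<open>Writing \<open>0\<close> as \<open>t - t\<close> prepares the composition with
    \<open>s \<mapsto> s - t\<close>, which moves the derivative from \<open>0\<close> to
    \<open>t\<close>.\<close>
  then have 1: "((\<lambda>h. \<phi> (\<gamma> (t + h))) has_derivative
     (\<lambda>h. h *\<^sub>R X (velocity B \<gamma> 0) (\<phi> (\<gamma> t)))) (at (t - t))" by simp
  have "((\<lambda>s. s - t) has_derivative (\<lambda>h. h)) (at t)" by (auto intro!: derivative_eq_intros)
  from has_derivative_compose[OF this 1]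
  show ?thesis by (simp add: has_vector_derivative_def)
qed

text \<open>Near \<open>0\<close> both curves solve the same differential equation from the same
  point; agreement on a short interval extends to the line by the group law.\<close>

lemma one_parameter_subgroup_unique:
  assumes \<gamma>: "one_parameter_subgroup G B \<gamma>" and \<delta>: "one_parameter_subgroup G B \<delta>"
    and eq: "velocity B \<gamma> 0 = velocity B \<delta> 0"
  shows "\<gamma> = \<delta>"
proof -
  let ?X = "X (velocity B \<gamma> 0)"
  obtain r L where r: "r > 0" "cball e r \<subseteq> W" "lipschitz_bound L (cball e r) ?X"
    using smooth_on_locally_lipschitz[OF frame smooth_X c0D(2) e_in_W] .
  have near: "\<exists>d>0. \<forall>t. \<bar>t\<bar> < d \<longrightarrow> \<alpha> t \<in> U \<and> \<phi> (\<alpha> t) \<in> cball e r" if "one_parameter_subgroup G B \<alpha>" for \<alpha>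
  proof -
    have sm: "smooth_map flat B \<alpha>" using that by (simp add: one_parameter_subgroup_def)
    note \<alpha>0 = one_parameter_subgroup_0[OF that]
    have "open (U \<inter> \<phi> -` ball e r)"
      by (rule continuous_open_preimage[OF c0D(3,1)]) simp
    then have "open (\<alpha> -` (U \<inter> \<phi> -` ball e r))" by (rule smooth_map_open_vimage[OF sm])
    moreover have "0 \<in> \<alpha> -` (U \<inter> \<phi> -` ball e r)" using \<alpha>0 c0 r by (simp add: e_def[symmetric])
    ultimately obtain d where "d > 0" "ball 0 d \<subseteq> \<alpha> -` (U \<inter> \<phi> -` ball e r)"
      unfolding open_contains_ball by blast
    then show ?thesis by (intro exI[of _ d]) (force simp: dist_norm)
  qed
  obtain d1 d2 where d: "d1 > 0" "\<And>t. \<bar>t\<bar> < d1 \<Longrightarrow> \<gamma> t \<in> U \<and> \<phi> (\<gamma> t) \<in> cball e r"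
    "d2 > 0" "\<And>t. \<bar>t\<bar> < d2 \<Longrightarrow> \<delta> t \<in> U \<and> \<phi> (\<delta> t) \<in> cball e r"
    using near[OF \<gamma>] near[OF \<delta>] by metis
  have L: "L \<ge> 0" using r by (simp add: lipschitz_bound_def)
  \<comment> \<open>Small enough for \<open>L * \<epsilon> < 1\<close> and for both curves to stay
    in the ball on which the Lipschitz estimate holds.\<close>
  define \<epsilon> where "\<epsilon> = min (1 / (2 * (L + 1))) (min d1 d2 / 2)"
  have \<epsilon>: "\<epsilon> > 0" "\<epsilon> < d1" "\<epsilon> < d2" using d L by (auto simp: \<epsilon>_def)
  have "L * \<epsilon> \<le> (L + 1) * (1 / (2 * (L + 1)))"
    using L \<epsilon> by (intro mult_mono) (auto simp: \<epsilon>_def)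
  also have "\<dots> < 1" using L by (simp add: divide_simps)
  finally have L\<epsilon>: "L * \<epsilon> < 1" .
  have *: "\<phi> (\<gamma> t) = \<phi> (\<delta> t)" if t: "t \<in> {-\<epsilon>..\<epsilon>}" for t
  proof (rule ode_solution_unique[OF r(3) _ L\<epsilon> _ _ _ t])
    show "\<phi> (\<gamma> 0) = \<phi> (\<delta> 0)" by (simp add: one_parameter_subgroup_0[OF \<gamma>] one_parameter_subgroup_0[OF \<delta>])
    fix s assume "s \<in> {-\<epsilon>..\<epsilon>}"
    then have s: "\<bar>s\<bar> < d1" "\<bar>s\<bar> < d2" using \<epsilon> by auto
    show "\<phi> (\<gamma> s) \<in> cball e r \<and> ((\<lambda>t. \<phi> (\<gamma> t)) has_vector_derivative ?X (\<phi> (\<gamma> s))) (at s within {-\<epsilon>..\<epsilon>})"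
      using d(2)[OF s(1)] one_parameter_subgroup_ode[OF \<gamma>, of s] has_vector_derivative_at_within by blast
    show "\<phi> (\<delta> s) \<in> cball e r \<and> ((\<lambda>t. \<phi> (\<delta> t)) has_vector_derivative ?X (\<phi> (\<delta> s))) (at s within {-\<epsilon>..\<epsilon>})"
      using d(4)[OF s(2)] one_parameter_subgroup_ode[OF \<delta>, of s] has_vector_derivative_at_within
      unfolding eq by blast
  qed (use \<epsilon> in auto)
  show ?thesis
  proof (rule one_parameter_eqI[of \<gamma> \<delta> \<epsilon>])
    fix t assume t: "\<bar>t\<bar> < \<epsilon>"
    then have "t \<in> {-\<epsilon>..\<epsilon>}" by auto
    from *[OF this] have "\<psi> (\<phi> (\<gamma> t)) = \<psi> (\<phi> (\<delta> t))" by simp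
    then show "\<gamma> t = \<delta> t" using d(2)[of t] d(4)[of t] t \<epsilon> c0D(5) by simp
  qed (use \<gamma> \<delta> \<epsilon> in \<open>auto simp: one_parameter_subgroup_def\<close>)
qed

text \<open>Near any \<open>t0\<close> the homomorphism is its own restriction near \<open>0\<close>
  followed by left translation by \<open>\<Gamma> t0\<close>, so smoothness at \<open>0\<close>
  spreads to the line.\<close>

lemma smooth_map_homI:
  fixes \<Gamma> :: "real \<Rightarrow> 'g"
  assumes hom: "\<And>s t. \<Gamma> (s + t) = \<Gamma> s \<otimes>\<^bsub>G\<^esub> \<Gamma> t" and \<delta>: "\<delta> > 0"
    and \<Gamma>: "\<And>t. \<bar>t\<bar> < \<delta> \<Longrightarrow> c t \<in> W \<and> \<Gamma> t = \<psi> (c t)" and c: "smooth_on {-\<delta><..<\<delta>} c"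
  shows "smooth_map flat B \<Gamma>"
proof -
  have \<Gamma>t: "\<Gamma> t = \<Gamma> t0 \<otimes>\<^bsub>G\<^esub> \<psi> (c (t - t0))" if "t \<in> {t0 - \<delta><..<t0 + \<delta>}" for t t0
    using hom[of t0 "t - t0"] \<Gamma>[of "t - t0"] that by auto
  have shift: "smooth_on {t0 - \<delta><..<t0 + \<delta>} (\<lambda>t. c (t - t0))" for t0
  proof (rule smooth_on_compose[OF parseval_frame_Basis _ _ c])
    show "smooth_on {t0 - \<delta><..<t0 + \<delta>} (\<lambda>t. t - t0)"
      using smooth_on_add[OF _ smooth_on_id smooth_on_const[of _ "- t0"], of "{t0 - \<delta><..<t0 + \<delta>}"] by simp
  qed auto
  have cont: "continuous_on {t0 - \<delta><..<t0 + \<delta>} \<Gamma>" for t0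
  proof -
    have "continuous_on {t0 - \<delta><..<t0 + \<delta>} (\<lambda>t. \<psi> (c (t - t0)))"
      using smooth_on_continuous[OF shift] by (rule continuous_on_compose2[OF c0D(4)]) (use \<Gamma> in auto)
    from continuous_on_compose2[OF smooth_map_continuous[OF smooth_map_left_mult[of "\<Gamma> t0"]] this]
    have "continuous_on {t0 - \<delta><..<t0 + \<delta>} (\<lambda>t. \<Gamma> t0 \<otimes>\<^bsub>G\<^esub> \<psi> (c (t - t0)))" by auto
    then show ?thesis by (rule continuous_on_eq) (simp add: \<Gamma>t)
  qed
  have "isCont \<Gamma> t0" for t0
    using cont[of t0] \<delta> by (simp add: continuous_on_eq_continuous_at)
  then have cont_\<Gamma>: "continuous_on UNIV \<Gamma>" by (simp add: continuous_at_imp_continuous_on)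
  have "smooth_on (\<Gamma> -` fst d) (\<lambda>t. snd d (\<Gamma> t))" if d: "d \<in> B" for d
  proof (rule smooth_on_local)
    fix t0 assume t0: "t0 \<in> \<Gamma> -` fst d"
    note dD = chartedD[OF B(2) d]
    define J where "J = {t0 - \<delta><..<t0 + \<delta>} \<inter> \<Gamma> -` fst d"
    have J: "open J"
      unfolding J_def using cont_\<Gamma> dD(1) by (intro open_Int open_vimage) auto
    have "smooth_on J (\<lambda>t. (\<lambda>y. snd d (\<Gamma> t0 \<otimes>\<^bsub>G\<^esub> \<psi> y)) (c (t - t0)))"
    proof (rule smooth_on_compose[OF frame J _ smooth_map_smooth_on[OF smooth_map_left_mult[of "\<Gamma> t0"] c0(1) d]])
      show "smooth_on J (\<lambda>t. c (t - t0))"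
        by (rule smooth_on_subset[OF shift[of t0]]) (auto simp: J_def)
      show "(\<lambda>t. c (t - t0)) ` J \<subseteq> \<phi> ` (U \<inter> (\<otimes>\<^bsub>G\<^esub>) (\<Gamma> t0) -` fst d)"
        unfolding chart_image_Int_eq[OF B(2) c0(1)] using \<Gamma> \<Gamma>t by (auto simp: J_def)
    qed
    then have "smooth_on J (\<lambda>t. snd d (\<Gamma> t))"
      by (rule smooth_on_cong[OF _ J]) (use \<Gamma>t in \<open>auto simp: J_def\<close>)
    then show "\<exists>U. open U \<and> t0 \<in> U \<and> smooth_on U (\<lambda>t. snd d (\<Gamma> t))"
      using J t0 \<delta> by (auto simp: J_def)
  qed
  then show ?thesis using cont_\<Gamma> by (auto simp: smooth_map_def flat_def o_def)
qed

text \<open>Left translation carries integral curves of \<open>X \<xi>\<close> to integral curves,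
  by the chain rule and \<open>left_invariance\<close>.\<close>

lemma translated_integral_curve:
  assumes "(u, c t) \<in> D" "(c has_vector_derivative X \<xi> (c t)) (at t)"
  shows "((\<lambda>t. m (u, c t)) has_vector_derivative X \<xi> (m (u, c t))) (at t)"
proof -
  interpret L: bounded_linear "frechet_derivative m (at (u, c t))"
    using m_has_derivative[OF assms(1)] by (rule has_derivative_bounded_linear)
  have "((\<lambda>t. (u, c t)) has_derivative (\<lambda>h. (0, h *\<^sub>R X \<xi> (c t)))) (at t)"
    using assms(2) unfolding has_vector_derivative_def by (intro has_derivative_Pair has_derivative_const)
  from has_derivative_compose[OF this m_has_derivative[OF assms(1)]]
  show ?thesis
    using L.scaleR[of _ "(0, X \<xi> (c t))"] by (simp add: has_vector_derivative_def left_invariance[OF assms(1)])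
qed

text \<open>For fixed \<open>s\<close> the curves \<open>m (c s, c t)\<close> and
  \<open>c (s + t)\<close> are both integral curves in \<open>t\<close> that start at
  \<open>c s\<close>. Their equality makes the Picard solution a local homomorphism, which then
  extends.\<close>

lemma one_parameter_subgroup_exists:
  obtains \<Gamma> where "one_parameter_subgroup G B \<Gamma>" "velocity B \<Gamma> 0 = \<xi>"
proof -
  obtain r L where r: "r > 0" "cball e r \<subseteq> W" "lipschitz_bound L (cball e r) (X \<xi>)"
    using smooth_on_locally_lipschitz[OF frame smooth_X c0D(2) e_in_W] .
  obtain \<epsilon> c where \<epsilon>: "\<epsilon> > 0" "c 0 = e" and c_in: "\<And>t. t \<in> {-\<epsilon>..\<epsilon>} \<Longrightarrow> c t \<in> cball e r"
    and c_within: "\<And>t. t \<in> {-\<epsilon>..\<epsilon>} \<Longrightarrow> (c has_vector_derivative X \<xi> (c t)) (at t within {-\<epsilon>..\<epsilon>})"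
    using picard_existence[OF frame r(1,3)] by metis
  have c_der: "(c has_vector_derivative X \<xi> (c t)) (at t)" if "\<bar>t\<bar> < \<epsilon>" for t
  proof -
    have "t \<in> {-\<epsilon><..<\<epsilon>}" using that by auto
    moreover have "(c has_vector_derivative X \<xi> (c t)) (at t within {-\<epsilon><..<\<epsilon>})"
      by (rule has_vector_derivative_within_subset[OF c_within]) (use that in auto)
    ultimately show ?thesis by (metis at_within_open open_greaterThanLessThan)
  qed
  have cW: "c t \<in> W" if "\<bar>t\<bar> < \<epsilon>" for t
  proof -
    have "t \<in> {-\<epsilon>..\<epsilon>}" using that by auto
    from c_in[OF this] show ?thesis using r(2) by blast
  qed
  have smooth_c: "smooth_on {-\<epsilon><..<\<epsilon>} c"
    by (rule smooth_on_integral_curve[OF frame smooth_X[of \<xi>]]) (use cW c_der in auto)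
  have L: "L \<ge> 0" using r by (simp add: lipschitz_bound_def)
  have ee: "(e, e) \<in> D" "m (e, e) = e" using m_e_left[OF e_in_W] by auto
  have "isCont c 0" using c_der[of 0] \<epsilon> has_vector_derivative_continuous by simp
  \<comment> \<open>The set where the product is defined in the chart and lands in the ball of the
    Lipschitz estimate, as uniqueness requires of the translated curve.\<close>
  define Q where "Q = D \<inter> m -` ball e r"
  have "open Q"
    unfolding Q_def by (rule continuous_open_preimage[OF smooth_on_continuous[OF smooth_m] open_D]) simp
  moreover have "(e, e) \<in> Q" using ee r by (simp add: Q_def)
  ultimately obtain P R where PR: "open P" "open R" "e \<in> P" "e \<in> R" "P \<times> R \<subseteq> Q"
    by (metis mem_Sigma_iff open_prod_elim)
  then have "open (P \<inter> R)" "c 0 \<in> P \<inter> R" using \<epsilon> by auto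
  then obtain T where T: "open T" "0 \<in> T" "\<And>t. t \<in> T \<Longrightarrow> c t \<in> P \<inter> R"
    using \<open>isCont c 0\<close> unfolding continuous_at_open by metis
  then obtain d where d: "d > 0" "ball 0 d \<subseteq> T" unfolding open_contains_ball by blast
  have Q: "(c s, c t) \<in> D" "m (c s, c t) \<in> cball e r" if "\<bar>s\<bar> < d" "\<bar>t\<bar> < d" for s t
  proof -
    have "s \<in> T" "t \<in> T" using d(2) that by (auto simp: dist_norm)
    then have "(c s, c t) \<in> Q" using T(3) PR(5) by blast
    then show "(c s, c t) \<in> D" "m (c s, c t) \<in> cball e r" by (auto simp: Q_def)
  qed
  \<comment> \<open>The first bound is for uniqueness; \<open>d\<close> keeps products in
    \<open>Q\<close>; a third of \<open>\<epsilon>\<close> gives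
    \<open>2 * \<delta> < \<epsilon>\<close>, so that \<open>c (s + t)\<close> is still on the
    Picard interval.\<close>
  define \<delta> where "\<delta> = min (1 / (2 * (L + 1))) (min d \<epsilon> / 3)"
  have \<delta>: "\<delta> > 0" "\<delta> < d" "2 * \<delta> < \<epsilon>" using d L \<epsilon> by (auto simp: \<delta>_def)
  have "L * \<delta> \<le> (L + 1) * (1 / (2 * (L + 1)))"
    using L \<delta> by (intro mult_mono) (auto simp: \<delta>_def)
  also have "\<dots> < 1" using L by (simp add: divide_simps)
  finally have L\<delta>: "L * \<delta> < 1" .
  have local_hom: "m (c s, c t) = c (s + t)" if s: "\<bar>s\<bar> < \<delta>" and t: "\<bar>t\<bar> < \<delta>" for s t
  proof (rule ode_solution_unique[OF r(3) _ L\<delta>, where u = "\<lambda>t. m (c s, c t)" and v = "\<lambda>t. c (s + t)"])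
    show "m (c s, c 0) = c (s + 0)" using m_e_right[of "c s"] cW[of s] s \<delta> \<epsilon> by simp
    fix t assume "t \<in> {-\<delta>..\<delta>}"
    then have t: "\<bar>t\<bar> < d" "\<bar>t\<bar> < \<epsilon>" "\<bar>s + t\<bar> < \<epsilon>" "\<bar>s\<bar> < d" using s \<delta> by auto
    show "m (c s, c t) \<in> cball e r \<and>
        ((\<lambda>t. m (c s, c t)) has_vector_derivative X \<xi> (m (c s, c t))) (at t within {-\<delta>..\<delta>})"
      using Q[OF t(4) t(1)] translated_integral_curve[where c = c, OF _ c_der[OF t(2)]]
        has_vector_derivative_at_within by blast
    have "((\<lambda>t. s + t) has_vector_derivative 1) (at t)"
      by (auto intro!: derivative_eq_intros)
    from vector_diff_chain_at[OF this c_der[OF t(3)]]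
    have "((\<lambda>t. c (s + t)) has_vector_derivative X \<xi> (c (s + t))) (at t)" by (simp add: o_def)
    moreover have "s + t \<in> {-\<epsilon>..\<epsilon>}" using t(3) by auto
    ultimately show "c (s + t) \<in> cball e r \<and>
        ((\<lambda>t. c (s + t)) has_vector_derivative X \<xi> (c (s + t))) (at t within {-\<delta>..\<delta>})"
      using c_in has_vector_derivative_at_within by blast
  qed (use \<delta> t in auto)
  have hom: "\<psi> (c (s + t)) = \<psi> (c s) \<otimes>\<^bsub>G\<^esub> \<psi> (c t)"
    if s: "\<bar>s\<bar> < \<delta>" and t: "\<bar>t\<bar> < \<delta>" and "\<bar>s + t\<bar> < \<delta>" for s t
  proof -
    have "(c s, c t) \<in> D" using Q[of s t] s t \<delta> by auto
    then show ?thesis using local_hom[OF s t, symmetric] c0D by (simp add: m_def D_def)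
  qed
  obtain \<Gamma> :: "real \<Rightarrow> 'g" where \<Gamma>: "\<And>s t. \<Gamma> (s + t) = \<Gamma> s \<otimes>\<^bsub>G\<^esub> \<Gamma> t" "\<And>t. \<bar>t\<bar> < \<delta> \<Longrightarrow> \<Gamma> t = \<psi> (c t)"
    using local_one_parameter_extension[OF \<delta>(1) in_carrier hom] by metis
  have "smooth_map flat B \<Gamma>"
  proof (rule smooth_map_homI[OF \<Gamma>(1) \<delta>(1)])
    show "smooth_on {-\<delta><..<\<delta>} c" by (rule smooth_on_subset[OF smooth_c]) (use \<delta> in auto)
    show "c t \<in> W \<and> \<Gamma> t = \<psi> (c t)" if "\<bar>t\<bar> < \<delta>" for t
      using \<Gamma>(2)[OF that] cW[of t] that \<delta> by auto
  qed
  moreover have "velocity B \<Gamma> 0 = \<xi>"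
  proof (rule velocity_eqI)
    have "(c has_vector_derivative \<xi>) (at 0)" using c_der[of 0] \<epsilon> X_e by simp
    then show "((\<lambda>t. \<phi> (\<Gamma> t)) has_vector_derivative \<xi>) (at 0)"
      by (rule has_vector_derivative_transform_within_open[of _ _ _ "{-\<delta><..<\<delta>}"])
        (use \<delta> \<Gamma>(2) cW c0D in auto)
    show "\<Gamma> 0 = \<one>\<^bsub>G\<^esub>" using \<Gamma>(2)[of 0] \<delta> \<epsilon> by simp
  qed
  ultimately show ?thesis using that[of \<Gamma>] \<Gamma>(1) by (simp add: one_parameter_subgroup_def)
qed

section \<open>The exponential map\<close>

definition flow where "flow \<xi> = (THE \<gamma>. one_parameter_subgroup G B \<gamma> \<and> velocity B \<gamma> 0 = \<xi>)"

text \<open>\<open>flow \<xi>\<close> names the description inside \<open>lie_exp\<close>; existence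
  and uniqueness together make it proper.\<close>

lemma flow: "one_parameter_subgroup G B (flow \<xi>)" "velocity B (flow \<xi>) 0 = \<xi>"
proof -
  have "\<exists>!\<gamma>. one_parameter_subgroup G B \<gamma> \<and> velocity B \<gamma> 0 = \<xi>"
    using one_parameter_subgroup_exists[of \<xi>] one_parameter_subgroup_unique by metis
  from theI'[OF this] show "one_parameter_subgroup G B (flow \<xi>)" "velocity B (flow \<xi>) 0 = \<xi>"
    by (auto simp: flow_def)
qed

lemma flow_smooth: "smooth_map flat B (flow \<xi>)"
  and flow_add: "flow \<xi> (s + t) = flow \<xi> s \<otimes>\<^bsub>G\<^esub> flow \<xi> t"
  using flow(1)[of \<xi>] by (auto simp: one_parameter_subgroup_def)

lemmas flow_0 = one_parameter_subgroup_0[OF flow(1)]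
  and flow_minus = one_parameter_subgroup_minus[OF flow(1)]

lemma flow_velocity: "((\<lambda>t. \<phi> (flow \<xi> t)) has_vector_derivative \<xi>) (at 0)"
  using has_vector_derivative_velocity[OF flow_smooth flow_0] by (simp add: flow(2))

text \<open>Running \<open>flow \<xi>\<close> at speed \<open>t\<close> gives a one-parameter
  subgroup with velocity \<open>t *\<^sub>R \<xi>\<close>, so uniqueness applies. This turns the
  curve in the definition of \<open>fundamental_vf\<close> into a smooth orbit.\<close>

lemma lie_exp_scaleR: "lie_exp G B (t *\<^sub>R \<xi>) = flow \<xi> t"
proof -
  have "(\<lambda>s. flow \<xi> (t * s)) = flow (t *\<^sub>R \<xi>)"
  proof (rule one_parameter_subgroup_unique[OF _ flow(1)])
    have "smooth_map flat flat (\<lambda>s. t * s)"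
      by (rule smooth_map_flatI) (auto simp: flat_def chart_image_def intro!: continuous_intros smooth_on_bounded_linear bounded_linear_mult_right)
    then have "smooth_map flat B (\<lambda>s. flow \<xi> (t * s))"
      by (rule smooth_map_compose[OF charted_flat charted_flat B(2) parseval_frame_Basis _ flow_smooth])
    then show "one_parameter_subgroup G B (\<lambda>s. flow \<xi> (t * s))"
      by (simp add: one_parameter_subgroup_def distrib_left flow_add)
    have "((\<lambda>s. t * s) has_vector_derivative t) (at 0)"
      by (auto intro!: derivative_eq_intros)
    then have "((\<lambda>s. \<phi> (flow \<xi> (t * s))) has_vector_derivative t *\<^sub>R \<xi>) (at 0)"
      using vector_diff_chain_at[of "\<lambda>s. t * s" t 0 "\<lambda>t. \<phi> (flow \<xi> t)" \<xi>] flow_velocity by (simp add: o_def)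
    then show "velocity B (\<lambda>s. flow \<xi> (t * s)) 0 = velocity B (flow (t *\<^sub>R \<xi>)) 0"
      using velocity_eqI[of "\<lambda>s. flow \<xi> (t * s)"] flow(2) flow_0 by simp
  qed
  from fun_cong[OF this, of 1] show ?thesis by (simp add: lie_exp_def flow_def)
qed

section \<open>The adjoint and coadjoint representations along a flow\<close>

lemma smooth_map_conj: "smooth_map B B (\<lambda>b. a \<otimes>\<^bsub>G\<^esub> b \<otimes>\<^bsub>G\<^esub> inv\<^bsub>G\<^esub> a)"
  by (rule smooth_map_mult[OF B(2) smooth_map_left_mult smooth_map_const])

lemma adjoint_rep_eq: "adjoint_rep G B a = chart_deriv c0 c0 (\<lambda>b. a \<otimes>\<^bsub>G\<^esub> b \<otimes>\<^bsub>G\<^esub> inv\<^bsub>G\<^esub> a) \<one>\<^bsub>G\<^esub>"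
  by (simp add: adjoint_rep_def tangent_map_eq_chart_deriv c0_def)

lemma adjoint_rep_bounded_linear: "bounded_linear (adjoint_rep G B a)"
  unfolding adjoint_rep_eq
  by (rule chart_deriv_bounded_linear[OF smooth_map_conj c0(1) c0(1) c0(2)]) (simp add: c0)

text \<open>Conjugation is the product of \<open>b \<mapsto> a b\<close> with the constant inverse
  of \<open>a\<close>, which contributes \<open>0\<close> in the second slot.\<close>

lemma adjoint_rep_in_chart:
  assumes "a \<in> U" "inv\<^bsub>G\<^esub> a \<in> U"
  shows "adjoint_rep G B a \<eta> = frechet_derivative m (at (\<phi> a, \<phi> (inv\<^bsub>G\<^esub> a))) (X \<eta> (\<phi> a), 0)"
  unfolding adjoint_rep_eq
  using chart_deriv_mult[OF B(2) smooth_map_left_mult smooth_map_const c0, of a "inv\<^bsub>G\<^esub> a" \<eta>] assms c0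
  by (simp add: chart_deriv_const chart_deriv_left_mult)

text \<open>In the chart the adjoint action of \<open>flow \<xi> t\<close> on \<open>\<eta>\<close> is \<open>Dm (c t, c (- t)) (X \<eta> (c t), 0)\<close>.
  Differentiating the second slot gives \<open>D (X \<eta>) \<xi>\<close>; differentiating the base point gives a second
  derivative of \<open>m\<close>, which by symmetry is \<open>- D (X \<xi>) \<eta>\<close>.\<close>

lemma adjoint_rep_flow_derivative:
  "((\<lambda>t. adjoint_rep G B (flow \<xi> t) \<eta>) has_vector_derivative lie_algebra_bracket G B \<xi> \<eta>) (at 0)"
proof -
  let ?c = "\<lambda>t. \<phi> (flow \<xi> t)"
  let ?D = "\<lambda>v y. frechet_derivative m (at y) v"
  have c0e: "?c 0 = e" by (simp add: flow_0 e_def)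
  have ee: "(e, e) \<in> D" using m_e_left[OF e_in_W] by simp
  have c: "(?c has_derivative (\<lambda>h. h *\<^sub>R \<xi>)) (at 0)"
    using flow_velocity by (simp add: has_vector_derivative_def)
  have "((\<lambda>t. - t) has_derivative (\<lambda>h. - h)) (at (0::real))" by (auto intro!: derivative_eq_intros)
  from has_derivative_compose[OF this, of ?c "\<lambda>h. h *\<^sub>R \<xi>"]
  have c': "((\<lambda>t. ?c (- t)) has_derivative (\<lambda>h. - h *\<^sub>R \<xi>)) (at 0)" using c by simp
  have p: "((\<lambda>t. (?c t, ?c (- t))) has_derivative (\<lambda>h. (h *\<^sub>R \<xi>, - h *\<^sub>R \<xi>))) (at 0)"
    by (intro has_derivative_Pair c c')
  have X_der: "(X \<eta> has_derivative frechet_derivative (X \<eta>) (at e)) (at e)" for \<eta>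
    by (rule smooth_on_has_derivative[OF smooth_X e_in_W])
  have "((\<lambda>t. X \<eta> (?c t)) has_derivative (\<lambda>h. frechet_derivative (X \<eta>) (at e) (h *\<^sub>R \<xi>))) (at 0)"
    using has_derivative_compose[OF c, of "X \<eta>"] X_der[of \<eta>] c0e by simp
  then have w: "((\<lambda>t. (X \<eta> (?c t), 0::'f)) has_derivative (\<lambda>h. (frechet_derivative (X \<eta>) (at e) (h *\<^sub>R \<xi>), 0))) (at 0)"
    by (intro has_derivative_Pair has_derivative_const)
  have "(?c 0, ?c (- 0)) \<in> D" using ee c0e by simp
  from has_derivative_frechet_derivative[OF frame_prod smooth_m open_D this p w]
  have main: "((\<lambda>t. ?D (X \<eta> (?c t), 0) (?c t, ?c (- t))) has_derivative
      (\<lambda>h. frechet_derivative (?D (\<eta>, 0)) (at (e, e)) (h *\<^sub>R \<xi>, - h *\<^sub>R \<xi>)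
        + frechet_derivative (X \<eta>) (at e) (h *\<^sub>R \<xi>))) (at 0)"
    by (simp add: c0e X_e deriv_m_left[OF e_in_W])
  \<comment> \<open>The chart formula for \<open>adjoint_rep\<close> requires both
    \<open>flow \<xi> t\<close> and its inverse to lie in \<open>U\<close>.\<close>
  define S where "S = flow \<xi> -` U \<inter> (\<lambda>t. flow \<xi> (- t)) -` U"
  have "open S"
  proof -
    have "open (flow \<xi> -` U)" by (rule smooth_map_open_vimage[OF flow_smooth c0D(1)])
    moreover from this have "open (uminus -` (flow \<xi> -` U))"
      by (rule open_vimage) (intro continuous_intros)
    ultimately show ?thesis by (simp add: S_def vimage_def open_Int)
  qed
  moreover have "0 \<in> S" using c0 flow_0 by (simp add: S_def)
  ultimately have der: "((\<lambda>t. adjoint_rep G B (flow \<xi> t) \<eta>) has_derivative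
      (\<lambda>h. frechet_derivative (?D (\<eta>, 0)) (at (e, e)) (h *\<^sub>R \<xi>, - h *\<^sub>R \<xi>)
        + frechet_derivative (X \<eta>) (at e) (h *\<^sub>R \<xi>))) (at 0)"
    by (rule has_derivative_transform_within_open[OF main])
      (simp add: S_def flow_minus adjoint_rep_in_chart)
  have second: "(?D v has_derivative frechet_derivative (?D v) (at (e, e))) (at (e, e))" for v
    by (rule smooth_on_has_derivative[OF smooth_on_frechet_derivative[OF smooth_m] ee])
  interpret L: bounded_linear "frechet_derivative (?D (\<eta>, 0)) (at (e, e))"
    using second by (rule has_derivative_bounded_linear)
  interpret M: bounded_linear "frechet_derivative (X \<eta>) (at e)"
    using X_der by (rule has_derivative_bounded_linear)
  have incl: "((\<lambda>u. (u, e)) has_derivative (\<lambda>v. (v, 0))) (at e)"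
    by (auto intro!: derivative_eq_intros)
  \<comment> \<open>Along the slice \<open>(u, e)\<close> the partial derivative applied to
    \<open>(\<eta>, 0)\<close> is constantly \<open>\<eta>\<close>, by
    \<open>deriv_m_left\<close>.\<close>
  have "frechet_derivative (?D (\<eta>, 0)) (at (e, e)) (\<xi>, 0) = 0"
  proof -
    have "((\<lambda>u. ?D (\<eta>, 0) (u, e)) has_derivative (\<lambda>v. frechet_derivative (?D (\<eta>, 0)) (at (e, e)) (v, 0))) (at e)"
      using has_derivative_compose[OF incl second] by simp
    then have "((\<lambda>u. \<eta>) has_derivative (\<lambda>v. frechet_derivative (?D (\<eta>, 0)) (at (e, e)) (v, 0))) (at e)"
      by (rule has_derivative_transform_within_open[OF _ c0D(2) e_in_W]) (simp add: deriv_m_left)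
    from fun_cong[OF has_derivative_unique[OF this has_derivative_const]] show ?thesis .
  qed
  \<comment> \<open>\<open>X \<xi>\<close> is the derivative of \<open>m\<close> in direction
    \<open>(0, \<xi>)\<close> on the slice \<open>(u, e)\<close>; differentiating it along
    \<open>\<eta>\<close> gives the same second derivative in the other order.\<close>
  moreover have "frechet_derivative (?D (\<eta>, 0)) (at (e, e)) (0, \<xi>) = frechet_derivative (X \<xi>) (at e) \<eta>"
  proof -
    have "(X \<xi> has_derivative (\<lambda>v. frechet_derivative (?D (0, \<xi>)) (at (e, e)) (v, 0))) (at e)"
      using has_derivative_compose[OF incl second[of "(0, \<xi>)"]] by (simp add: X_def[abs_def])
    then have "frechet_derivative (X \<xi>) (at e) \<eta> = frechet_derivative (?D (0, \<xi>)) (at (e, e)) (\<eta>, 0)"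
      by (simp add: frechet_derivative_eqI)
    also have "\<dots> = frechet_derivative (?D (\<eta>, 0)) (at (e, e)) (0, \<xi>)"
      by (rule mixed_derivatives_eq[OF smooth_m open_D ee])
    finally show ?thesis by simp
  qed
  moreover have "(h *\<^sub>R \<xi>, - h *\<^sub>R \<xi>) = h *\<^sub>R (\<xi>, 0) - h *\<^sub>R (0, \<xi>)" for h by simp
  ultimately have "frechet_derivative (?D (\<eta>, 0)) (at (e, e)) (h *\<^sub>R \<xi>, - h *\<^sub>R \<xi>)
        + frechet_derivative (X \<eta>) (at e) (h *\<^sub>R \<xi>) = h *\<^sub>R lie_algebra_bracket G B \<xi> \<eta>" for h
    by (simp only: L.diff L.scaleR M.scaleR lie_algebra_bracket_eq) (simp add: algebra_simps)
  then show ?thesis using der by (simp add: has_vector_derivative_def)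
qed

lemma coadjoint_rep_apply: "blinfun_apply (coadjoint_rep G B a l) \<eta> = l (adjoint_rep G B (inv\<^bsub>G\<^esub> a) \<eta>)"
  by (simp add: coadjoint_rep_def bounded_linear_Blinfun_apply[OF adjoint_rep_bounded_linear])

text \<open>The coadjoint action uses the inverse of \<open>flow \<xi> t\<close>, that is
  \<open>flow \<xi> (- t)\<close>, whence the minus sign.\<close>

lemma coadjoint_rep_flow_derivative:
  "((\<lambda>t. blinfun_apply (coadjoint_rep G B (flow \<xi> t) l) \<eta>) has_vector_derivative
     - l (lie_algebra_bracket G B \<xi> \<eta>)) (at 0)"
proof -
  have "((\<lambda>t. - t) has_vector_derivative - 1) (at (0::real))"
    by (auto intro!: derivative_eq_intros)
  then have "((\<lambda>t. adjoint_rep G B (flow \<xi> (- t)) \<eta>) has_vector_derivative - lie_algebra_bracket G B \<xi> \<eta>) (at 0)"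
    using vector_diff_chain_at[of "\<lambda>t. - t" "- 1" 0 "\<lambda>t. adjoint_rep G B (flow \<xi> t) \<eta>"] adjoint_rep_flow_derivative
    by (simp add: o_def)
  then have "((\<lambda>t. l (adjoint_rep G B (flow \<xi> (- t)) \<eta>)) has_vector_derivative l (- lie_algebra_bracket G B \<xi> \<eta>)) (at 0)"
    by (rule bounded_linear.has_vector_derivative[OF blinfun.bounded_linear_right])
  then show ?thesis by (simp add: coadjoint_rep_apply flow_minus blinfun.minus_right)
qed

end

section \<open>Momentum maps\<close>

lemma tangent_map_flat_flat: "tangent_map flat flat h t v = frechet_derivative h (at t) v"
  by (simp add: tangent_map_def chart_at_flat o_def)

lemma diff_eq: "diff A f x = frechet_derivative (\<lambda>y. f (chart_inv (chart_at A x) y)) (at (snd (chart_at A x) x))"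
  by (simp add: tangent_map_def chart_at_flat o_def)

lemma diff_const: "diff A (\<lambda>_. w) x v = 0"
  by (simp add: diff_eq)

lemma diff_has_derivative:
  assumes "charted A" "smooth_map A flat f"
  shows "((\<lambda>y. f (chart_inv (chart_at A x) y)) has_derivative diff A f x) (at (snd (chart_at A x) x))"
  unfolding diff_eq
  using smooth_on_has_derivative[OF smooth_map_flatD[OF assms(2) charted_chart_at(1)[OF assms(1)]]]
    chartedD(6)[OF assms(1) charted_chart_at[OF assms(1)]] by blast

lemma smooth_map_linear_comp:
  assumes "charted A" "bounded_linear L" "smooth_map A flat f"
  shows "smooth_map A flat (\<lambda>x. L (f x))"
proof (rule smooth_map_flatI)
  show "continuous_on UNIV (\<lambda>x. L (f x))"
    by (rule bounded_linear.continuous_on[OF assms(2) smooth_map_continuous[OF assms(3)]])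
qed (rule smooth_on_linear_comp[OF chartedD(2)[OF assms(1)] assms(2) smooth_map_flatD[OF assms(3)]])

lemma smooth_map_sum:
  assumes "charted A" "\<And>i. i \<in> J \<Longrightarrow> smooth_map A flat (f i)"
  shows "smooth_map A flat (\<lambda>x. \<Sum>i\<in>J. f i x)"
proof (rule smooth_map_flatI)
  show "continuous_on UNIV (\<lambda>x. \<Sum>i\<in>J. f i x)"
    by (intro continuous_on_sum smooth_map_continuous[OF assms(2)])
qed (intro smooth_on_sum chartedD(2)[OF assms(1)] smooth_map_flatD[OF assms(2)])

section \<open>Vector-valued forms and momentum maps by components\<close>

lemma sum_scaleR_axis:
  fixes r :: "'n::finite \<Rightarrow> real"
  shows "(\<Sum>a\<in>UNIV. r a *\<^sub>R axis a 1) = (\<chi> a. r a)"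
  by (simp add: vec_eq_iff axis_def if_distrib cong: if_cong)

lemma has_derivative_sum_axis:
  fixes f :: "'n::finite \<Rightarrow> 'a::real_normed_vector \<Rightarrow> real"
  assumes "\<And>a. (f a has_derivative f' a) F"
  shows "((\<lambda>y. \<Sum>a\<in>UNIV. f a y *\<^sub>R axis a 1 :: real ^ 'n) has_derivative (\<lambda>v. \<Sum>a\<in>UNIV. f' a v *\<^sub>R axis a 1)) F"
  by (intro has_derivative_sum has_derivative_scaleR_left assms)

lemma one_plectic_sum_axis:
  fixes \<omega> :: "'n::finite \<Rightarrow> 'm::topological_space \<Rightarrow> 'e::real_normed_vector \<Rightarrow> 'e \<Rightarrow> real"
  assumes A: "charted A" and \<omega>: "\<And>a. one_plectic A (\<omega> a)"
  shows "one_plectic A (\<lambda>x u v. \<Sum>a\<in>UNIV. \<omega> a x u v *\<^sub>R axis a 1 :: real ^ 'n)"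
proof -
  let ?\<Omega> = "\<lambda>x u v. \<Sum>a\<in>UNIV. \<omega> a x u v *\<^sub>R axis a 1 :: real ^ 'n"
  have bil: "bilinear (\<omega> a x)" and smooth: "c \<in> A \<Longrightarrow> smooth_on (chart_image c) (\<lambda>y. bilinear_in_chart A (\<omega> a) c y u v)"
    and alt: "\<omega> a x u u = 0" and closed: "closed_two_form A (\<omega> a)"
    and nondeg: "\<forall>v. \<omega> a x u v = 0 \<Longrightarrow> u = 0" for a x c u v
    using \<omega>[of a] by (auto simp: one_plectic_def two_form_def smooth_bilinear_field_def)
  have in_chart: "bilinear_in_chart A ?\<Omega> c y u v = (\<Sum>a\<in>UNIV. bilinear_in_chart A (\<omega> a) c y u v *\<^sub>R axis a 1)" for c y u v
    by (simp add: bilinear_in_chart_def)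
  have "bilinear (?\<Omega> x)" for x
    using bil by (simp add: bilinear_def linear_iff sum_scaleR_axis vec_eq_iff)
  moreover have "smooth_on (chart_image c) (\<lambda>y. bilinear_in_chart A ?\<Omega> c y u v)" if "c \<in> A" for c u v
    unfolding in_chart using chartedD(2)[OF A that]
    by (intro smooth_on_sum smooth_on_linear_comp[OF _ bounded_linear_scaleR_left] smooth[OF that])
  moreover have "?\<Omega> x u u = 0" for x u by (simp add: alt)
  moreover have "closed_two_form A ?\<Omega>"
    unfolding closed_two_form_def
  proof (intro ballI allI)
    fix c y u v w assume c: "c \<in> A" "y \<in> chart_image c"
    have D: "frechet_derivative (\<lambda>y. bilinear_in_chart A ?\<Omega> c y u v) (at y) w
      = (\<chi> a. frechet_derivative (\<lambda>y. bilinear_in_chart A (\<omega> a) c y u v) (at y) w)" for u v w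
    proof -
      have "((\<lambda>y. bilinear_in_chart A ?\<Omega> c y u v) has_derivative
          (\<lambda>w. \<Sum>a\<in>UNIV. frechet_derivative (\<lambda>y. bilinear_in_chart A (\<omega> a) c y u v) (at y) w *\<^sub>R axis a 1)) (at y)"
        unfolding in_chart by (intro has_derivative_sum_axis smooth_on_has_derivative[OF smooth[OF c(1)] c(2)])
      from frechet_derivative_eqI[OF this] show ?thesis by (simp only: sum_scaleR_axis)
    qed
    show "frechet_derivative (\<lambda>y. bilinear_in_chart A ?\<Omega> c y v w) (at y) u -
      frechet_derivative (\<lambda>y. bilinear_in_chart A ?\<Omega> c y u w) (at y) v +
      frechet_derivative (\<lambda>y. bilinear_in_chart A ?\<Omega> c y u v) (at y) w = 0"
      unfolding D using closed c by (simp add: vec_eq_iff closed_two_form_def)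
  qed
  moreover have "u = 0" if "\<And>v. ?\<Omega> x u v = 0" for x u
  \<comment> \<open>Non-degeneracy of one component suffices; \<open>undefined\<close> stands for an
    arbitrary index.\<close>
  proof (rule nondeg[of undefined x u])
    show "\<forall>v. \<omega> undefined x u v = 0"
      using that by (simp add: sum_scaleR_axis vec_eq_iff)
  qed
  ultimately show ?thesis
    unfolding one_plectic_def two_form_def smooth_bilinear_field_def by blast
qed

lemma hyper_kaehler_momentum_map_apply:
  "blinfun_apply (hyper_kaehler_momentum_map \<mu> x) \<xi> = (\<Sum>a\<in>UNIV. blinfun_apply (\<mu> a x) \<xi> *\<^sub>R axis a 1)"
  by (simp add: hyper_kaehler_momentum_map_def blinfun.sum_left)

lemma smooth_hyper_kaehler_momentum_map:
  assumes "charted A" "\<And>a. smooth_map A flat (\<mu> a)"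
  shows "smooth_map A flat (hyper_kaehler_momentum_map \<mu>)"
proof -
  have "smooth_map A flat (\<lambda>x. \<Sum>a\<in>UNIV. blinfun_scaleR_left (axis a 1) o\<^sub>L \<mu> a x)"
    by (rule smooth_map_sum[OF assms(1) smooth_map_linear_comp[OF assms(1)
          bounded_bilinear.bounded_linear_right[OF bounded_bilinear_blinfun_compose] assms(2)]])
  then show ?thesis by (simp add: hyper_kaehler_momentum_map_def[abs_def])
qed

text \<open>The image of the identity is an idempotent injective map, hence the identity map. This
  avoids showing that \<open>isometry_group\<close> is a group.\<close>

lemma hom_isometry_group_one:
  assumes "Group.group G" "\<Phi> \<in> hom G (isometry_group A g)"
  shows "\<Phi> \<one>\<^bsub>G\<^esub> x = x"
proof -
  interpret Group.group G by fact
  have "\<Phi> (\<one>\<^bsub>G\<^esub> \<otimes>\<^bsub>G\<^esub> \<one>\<^bsub>G\<^esub>) = \<Phi> \<one>\<^bsub>G\<^esub> \<circ> \<Phi> \<one>\<^bsub>G\<^esub>"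
    using hom_mult[OF assms(2) one_closed one_closed] by (simp add: isometry_group_def)
  then have "\<Phi> \<one>\<^bsub>G\<^esub> (\<Phi> \<one>\<^bsub>G\<^esub> x) = \<Phi> \<one>\<^bsub>G\<^esub> x"
    by (metis comp_apply l_one one_closed)
  moreover have "inj (\<Phi> \<one>\<^bsub>G\<^esub>)"
    using hom_in_carrier[OF assms(2) one_closed] by (auto simp: isometry_group_def bij_def)
  ultimately show ?thesis by (simp add: inj_eq)
qed

section \<open>Infinitesimal equivariance\<close>

context lie_group_charts
begin

text \<open>The fundamental field is the velocity of the orbit through \<open>x\<close>, so the
  chain rule turns a derivative along it into an ordinary derivative at
  \<open>t = 0\<close>.\<close>

lemma diff_fundamental_vf:
  fixes A :: "('m::{t2_space,second_countable_topology}, 'e::real_inner) chart set"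
  assumes A: "smooth_manifold A" and \<Phi>: "smooth_map (prod_atlas B A) A (\<lambda>(a, x). \<Phi> a x)"
    and one: "\<Phi> \<one>\<^bsub>G\<^esub> x = x" and f: "smooth_map A flat f"
  shows "diff A f x (fundamental_vf G B A \<Phi> \<xi> x) = frechet_derivative (\<lambda>t. f (\<Phi> (flow \<xi> t) x)) (at 0) 1"
proof -
  obtain E :: "'e set" where E: "parseval_frame E" using smooth_manifold_parseval_frame[OF A] .
  note A' = smooth_manifold_charted[OF A]
  have orbit: "smooth_map flat A (\<lambda>t. \<Phi> (flow \<xi> t) x)"
    using smooth_map_compose[OF charted_flat charted_prod[OF B(2) A'] A' parseval_frame_prod[OF frame E]
        smooth_map_Pair[OF charted_flat B(2) A' flow_smooth smooth_map_const] \<Phi>]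
    by simp
  have "fundamental_vf G B A \<Phi> \<xi> x = tangent_map flat A (\<lambda>t. \<Phi> (flow \<xi> t) x) 0 1"
    by (simp add: fundamental_vf_def velocity_def lie_exp_scaleR)
  then show ?thesis
    using tangent_map_compose[OF charted_flat A' charted_flat orbit f, of 0 1]
    by (simp add: flow_0 one tangent_map_flat_flat)
qed

text \<open>Along the orbit, equivariance replaces \<open>\<mu>\<close> by the coadjoint action on
  the fixed covector \<open>\<mu> x\<close>, so only the group element is left to
  differentiate.\<close>

lemma infinitesimal_equivariance:
  fixes A :: "('m::{t2_space,second_countable_topology}, 'e::real_inner) chart set"
  assumes A: "smooth_manifold A" and \<Phi>: "smooth_map (prod_atlas B A) A (\<lambda>(a, x). \<Phi> a x)"
    and one: "\<And>x. \<Phi> \<one>\<^bsub>G\<^esub> x = x" and \<mu>: "momentum_map G B A \<Phi> \<omega> \<mu>"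
  shows "diff A (\<lambda>x. blinfun_apply (\<mu> x) \<eta>) x (fundamental_vf G B A \<Phi> \<xi> x)
    = - blinfun_apply (\<mu> x) (lie_algebra_bracket G B \<xi> \<eta>)"
proof -
  have sm: "smooth_map A flat \<mu>" and eq: "\<And>a. \<mu> (\<Phi> a x) = coadjoint_rep G B a (\<mu> x)"
    using \<mu> by (auto simp: momentum_map_def)
  have "smooth_map A flat (\<lambda>x. blinfun_apply (\<mu> x) \<eta>)"
    by (rule smooth_map_linear_comp[OF smooth_manifold_charted[OF A] blinfun.bounded_linear_left sm])
  from diff_fundamental_vf[OF A \<Phi> one this]
  show ?thesis
    using coadjoint_rep_flow_derivative[of \<xi> "\<mu> x" \<eta>]
    by (simp add: eq has_vector_derivative_def frechet_derivative_eqI)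
qed

end

theorem proposition4p5:
  fixes A :: "('m::{t2_space,second_countable_topology}, 'e::euclidean_space) chart set"
    and g :: "'m \<Rightarrow> 'e \<Rightarrow> 'e \<Rightarrow> real"
    and I :: "3 \<Rightarrow> 'm \<Rightarrow> 'e \<Rightarrow> 'e"
    and G :: "('g::{t2_space,second_countable_topology}) monoid"
    and B :: "('g, 'f::{real_inner,complete_space}) chart set"
    and \<Phi> :: "'g \<Rightarrow> 'm \<Rightarrow> 'm"
    and \<mu> :: "3 \<Rightarrow> 'm \<Rightarrow> 'f \<Rightarrow>\<^sub>L real"
  assumes "hyper_kaehler A g I"
    and "lie_subgroup_of_isometries G B A g \<Phi>"
    and "compact (UNIV :: 'g set)"
    and "proper_action \<Phi>"
    and "free_action G \<Phi>"
    and "hyper_hamiltonian G B A \<Phi> g I \<mu>"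
  shows "one_plectic A (hyper_kaehler_form g I) \<and>
    homotopy_momentum_section_on_constants A (action_anchor G B A \<Phi>) (action_bracket G B A \<Phi>)
      (hyper_kaehler_form g I) (hyper_kaehler_momentum_map \<mu>)"
proof
  have A: "smooth_manifold A" and symp: "symplectic A (fundamental_form g (I a))" for a
    using assms(1) by (auto simp: hyper_kaehler_def kaehler_def)
  note A' = smooth_manifold_charted[OF A]
  have lie: "lie_group G B" and hom: "\<Phi> \<in> hom G (isometry_group A g)"
    and \<Phi>: "smooth_map (prod_atlas B A) A (\<lambda>(a, x). \<Phi> a x)"
    using assms(2) by (auto simp: lie_subgroup_of_isometries_def)
  interpret lie_group_charts G B by unfold_locales fact
  have \<mu>: "momentum_map G B A \<Phi> (fundamental_form g (I a)) (\<mu> a)" for a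
    using assms(6) by (simp add: hyper_hamiltonian_def)
  then have sm: "smooth_map A flat (\<mu> a)" for a by (simp add: momentum_map_def)
  let ?\<rho> = "fundamental_vf G B A \<Phi>"
  show "one_plectic A (hyper_kaehler_form g I)"
    using one_plectic_sum_axis[OF A' symp] by (simp add: hyper_kaehler_form_def[abs_def])
  have pairing: "pairing (hyper_kaehler_momentum_map \<mu>) \<alpha> x = (\<Sum>a\<in>UNIV. blinfun_apply (\<mu> a x) (\<alpha> x) *\<^sub>R axis a 1)" for \<alpha> x
    by (simp add: pairing_def hyper_kaehler_momentum_map_apply)
  have diff_sum: "diff A (pairing (hyper_kaehler_momentum_map \<mu>) (\<lambda>_. \<xi>)) x v
      = (\<Sum>a\<in>UNIV. diff A (\<lambda>x. blinfun_apply (\<mu> a x) \<xi>) x v *\<^sub>R axis a 1)" for \<xi> x v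
  proof -
    have sm': "smooth_map A flat (\<lambda>x. blinfun_apply (\<mu> a x) \<xi>)" for a
      by (rule smooth_map_linear_comp[OF A' blinfun.bounded_linear_left sm])
    have "((\<lambda>y. \<Sum>a\<in>UNIV. blinfun_apply (\<mu> a (chart_inv (chart_at A x) y)) \<xi> *\<^sub>R axis a 1 :: real ^ 3) has_derivative
        (\<lambda>v. \<Sum>a\<in>UNIV. diff A (\<lambda>x. blinfun_apply (\<mu> a x) \<xi>) x v *\<^sub>R axis a 1)) (at (snd (chart_at A x) x))"
      by (rule has_derivative_sum_axis) (rule diff_has_derivative[OF A' sm'])
    from frechet_derivative_eqI[OF this]
    show ?thesis by (simp only: diff_eq[of A "pairing _ _"] pairing)
  qed
  have i: "diff A (pairing (hyper_kaehler_momentum_map \<mu>) (\<lambda>_. \<xi>)) x v = hyper_kaehler_form g I x (?\<rho> \<xi> x) v" for \<xi> x v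
    using \<mu> by (simp add: diff_sum momentum_map_def hyper_kaehler_form_def)
  \<comment> \<open>On constant sections the derivative terms of the algebroid bracket vanish, and
    its minus sign is the one produced by the coadjoint action.\<close>
  have equivariance: "diff A (pairing (hyper_kaehler_momentum_map \<mu>) (\<lambda>_. \<eta>)) x (?\<rho> \<xi> x)
      = pairing (hyper_kaehler_momentum_map \<mu>) (action_bracket G B A \<Phi> (\<lambda>_. \<xi>) (\<lambda>_. \<eta>)) x" for \<xi> \<eta> x
    using infinitesimal_equivariance[OF A \<Phi> hom_isometry_group_one[OF is_group hom] \<mu>]
    by (simp add: diff_sum pairing action_bracket_def diff_const blinfun.minus_right)
  show "homotopy_momentum_section_on_constants A (action_anchor G B A \<Phi>) (action_bracket G B A \<Phi>)
      (hyper_kaehler_form g I) (hyper_kaehler_momentum_map \<mu>)"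
    unfolding homotopy_momentum_section_on_constants_def Let_def
  proof (intro conjI allI impI)
    show "smooth_map A flat (hyper_kaehler_momentum_map \<mu>)"
      by (rule smooth_hyper_kaehler_momentum_map[OF A' sm])
    fix \<xi> \<eta> :: 'f and x
    show "diff A (pairing (hyper_kaehler_momentum_map \<mu>) (\<lambda>_. \<xi>)) x (X x) =
      hyper_kaehler_form g I x (action_anchor G B A \<Phi> (\<lambda>_. \<xi>) x) (X x)" for X
      by (simp add: i action_anchor_def)
    \<comment> \<open>The first and third terms cancel by \<open>equivariance\<close>; the middle
      term is the first condition evaluated on the fundamental field of
      \<open>\<eta>\<close>.\<close>
    show "diff A (pairing (hyper_kaehler_momentum_map \<mu>) (\<lambda>_. \<eta>)) x (action_anchor G B A \<Phi> (\<lambda>_. \<xi>) x) -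
      diff A (pairing (hyper_kaehler_momentum_map \<mu>) (\<lambda>_. \<xi>)) x (action_anchor G B A \<Phi> (\<lambda>_. \<eta>) x) -
      pairing (hyper_kaehler_momentum_map \<mu>) (action_bracket G B A \<Phi> (\<lambda>_. \<xi>) (\<lambda>_. \<eta>)) x =
      - hyper_kaehler_form g I x (action_anchor G B A \<Phi> (\<lambda>_. \<xi>) x) (action_anchor G B A \<Phi> (\<lambda>_. \<eta>) x)"
      unfolding action_anchor_def using equivariance[of \<eta> x \<xi>] i[of \<xi> x "?\<rho> \<eta> x"] by simp
  qed
qed

end
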